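(* The minimizers $u_\varepsilon$ of $\mathcal J_\varepsilon$ satisfy $u_\varepsilon\to u$ in $W_0^{1,p}(\Omega)$ as $\varepsilon\to[0,\infty]$, where $u$ is the minimizer of $\mathcal J$.
   Context: Standing setting: $\Omega\subset\mathbb R^d$ is open and bounded, $1<p<2$, $f\in (W_0^{1,p}(\Omega))^*$. The energy is $\mathcal J(v):=\frac1p\int_\Omega|\nabla v|^p\,dx-\langle f,v\rangle$ on $W_0^{1,p}(\Omega)$ and $u$ is its unique minimizer. For $\varepsilon=[\varepsilon_-,\varepsilon_+]$ with $0<\varepsilon_-\le\varepsilon_+<\infty$ define $$\kappa_\varepsilon(t):=\begin{cases}\frac12\varepsilon_-^{p-2}t^2+(\frac1p-\frac12)\varepsilon_-^p & t\le\varepsilon_-,\\ \frac1p t^p & \varepsilon_-\le t\le\varepsilon_+,\\ \frac12\varepsilon_+^{p-2}t^2+(\frac1p-\frac12)\varepsilon_+^p & t\ge\varepsilon_+,\end{cases}$$ and $\mathcal J_\varepsilon(v):=\int_\Omega\kappa_\varepsilon(|\nabla v|)\,dx-\langle f,v\rangle$, as a functional $W_0^{1,p}(\Omega)\to\mathbb R\cup\{\infty\}$ (finite exactly on $W_0^{1,2}(\Omega)$); $u_\varepsilon$ is its unique minimizer. The notation $\varepsilon\to[0,\infty]$ means $\varepsilon_-\searrow0$ and $\varepsilon_+\nearrow\infty$. *)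

theory Defs
  imports "HOL-Analysis.Analysis"
begin

text \<open>\<open>C^k\<close> on the whole space, by recursion on directional derivatives. Differentiability is the
  (total) Frechet one, so \<^const>\<open>frechet_derivative\<close> is never evaluated at a bad point.\<close>

fun Ck :: "nat \<Rightarrow> ('a::euclidean_space \<Rightarrow> real) \<Rightarrow> bool" where
  "Ck 0 \<phi> \<longleftrightarrow> continuous_on UNIV \<phi>"
| "Ck (Suc k) \<phi> \<longleftrightarrow> (\<forall>x. \<phi> differentiable (at x)) \<and>
     (\<forall>i\<in>Basis. Ck k (\<lambda>x. frechet_derivative \<phi> (at x) i))"

definition test_functions :: "'a::euclidean_space set \<Rightarrow> ('a \<Rightarrow> real) set" where
  "test_functions \<Omega> = {\<phi>. (\<forall>k. Ck k \<phi>) \<and> compact (closure {x. \<phi> x \<noteq> 0}) \<and>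
     closure {x. \<phi> x \<noteq> 0} \<subseteq> \<Omega>}"

text \<open>Elements of function spaces are represented by functions on the whole space; only their values
  almost everywhere on \<open>\<Omega>\<close> matter, and all norms are seminorms on representatives.\<close>

definition Lp :: "'a::euclidean_space set \<Rightarrow> real \<Rightarrow> ('a \<Rightarrow> 'b::euclidean_space) set" where
  "Lp \<Omega> p = {v \<in> borel_measurable (lebesgue_on \<Omega>).
     integrable (lebesgue_on \<Omega>) (\<lambda>x. norm (v x) powr p)}"

definition locally_integrable :: "'a::euclidean_space set \<Rightarrow> ('a \<Rightarrow> 'b::euclidean_space) \<Rightarrow> bool" where
  "locally_integrable \<Omega> v \<longleftrightarrow> (\<forall>K. compact K \<and> K \<subseteq> \<Omega> \<longrightarrow> integrable (lebesgue_on K) v)"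

definition has_weak_gradient ::
    "'a::euclidean_space set \<Rightarrow> ('a \<Rightarrow> real) \<Rightarrow> ('a \<Rightarrow> 'a) \<Rightarrow> bool" where
  "has_weak_gradient \<Omega> v g \<longleftrightarrow> locally_integrable \<Omega> v \<and> locally_integrable \<Omega> g \<and>
     (\<forall>\<phi>\<in>test_functions \<Omega>. \<forall>i\<in>Basis.
        (LINT x|lebesgue_on \<Omega>. v x * frechet_derivative \<phi> (at x) i) =
        - (LINT x|lebesgue_on \<Omega>. (g x \<bullet> i) * \<phi> x))"

text \<open>The weak gradient is unique only up to null sets, hence the choice of a representative.\<close>

definition weak_gradient :: "'a::euclidean_space set \<Rightarrow> ('a \<Rightarrow> real) \<Rightarrow> 'a \<Rightarrow> 'a" where
  "weak_gradient \<Omega> v = (SOME g. has_weak_gradient \<Omega> v g)"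

definition W1p :: "'a::euclidean_space set \<Rightarrow> real \<Rightarrow> ('a \<Rightarrow> real) set" where
  "W1p \<Omega> p = {v \<in> Lp \<Omega> p. \<exists>g\<in>Lp \<Omega> p. has_weak_gradient \<Omega> v g}"

definition W1p_norm :: "'a::euclidean_space set \<Rightarrow> real \<Rightarrow> ('a \<Rightarrow> real) \<Rightarrow> real" where
  "W1p_norm \<Omega> p v =
     ((LINT x|lebesgue_on \<Omega>. \<bar>v x\<bar> powr p) +
      (LINT x|lebesgue_on \<Omega>. norm (weak_gradient \<Omega> v x) powr p)) powr (1 / p)"

definition W1p0 :: "'a::euclidean_space set \<Rightarrow> real \<Rightarrow> ('a \<Rightarrow> real) set" where
  "W1p0 \<Omega> p = {v \<in> W1p \<Omega> p. \<exists>\<phi>. (\<forall>n. \<phi> n \<in> test_functions \<Omega>) \<and>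
     (\<lambda>n::nat. W1p_norm \<Omega> p (\<lambda>x. \<phi> n x - v x)) \<longlonglongrightarrow> 0}"

text \<open>Boundedness forces such a functional to respect almost everywhere equality on \<open>\<Omega>\<close>.\<close>

definition W1p0_dual :: "'a::euclidean_space set \<Rightarrow> real \<Rightarrow> (('a \<Rightarrow> real) \<Rightarrow> real) set" where
  "W1p0_dual \<Omega> p = {f.
     (\<forall>v\<in>W1p0 \<Omega> p. \<forall>w\<in>W1p0 \<Omega> p. f (\<lambda>x. v x + w x) = f v + f w) \<and>
     (\<forall>c. \<forall>v\<in>W1p0 \<Omega> p. f (\<lambda>x. c * v x) = c * f v) \<and>
     (\<exists>C. \<forall>v\<in>W1p0 \<Omega> p. \<bar>f v\<bar> \<le> C * W1p_norm \<Omega> p v)}"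

definition energy ::
    "'a::euclidean_space set \<Rightarrow> real \<Rightarrow> (('a \<Rightarrow> real) \<Rightarrow> real) \<Rightarrow> ('a \<Rightarrow> real) \<Rightarrow> real" where
  "energy \<Omega> p f v =
     1 / p * (LINT x|lebesgue_on \<Omega>. norm (weak_gradient \<Omega> v x) powr p) - f v"

definition kappa :: "real \<Rightarrow> real \<Rightarrow> real \<Rightarrow> real \<Rightarrow> real" where
  "kappa p em ep t =
     (if t \<le> em then 1 / 2 * em powr (p - 2) * t\<^sup>2 + (1 / p - 1 / 2) * em powr p
      else if t \<le> ep then 1 / p * t powr p
      else 1 / 2 * ep powr (p - 2) * t\<^sup>2 + (1 / p - 1 / 2) * ep powr p)"

text \<open>For \<open>0 < p < 2\<close> the integrand is nonnegative, so the nonnegative Lebesgue integral is the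
  integral with value \<open>\<infinity>\<close> where the integrand is not integrable, i.e. where the weak gradient is not square integrable.\<close>

definition relaxed_energy ::
    "'a::euclidean_space set \<Rightarrow> real \<Rightarrow> (('a \<Rightarrow> real) \<Rightarrow> real) \<Rightarrow> real \<Rightarrow> real \<Rightarrow>
     ('a \<Rightarrow> real) \<Rightarrow> ereal" where
  "relaxed_energy \<Omega> p f em ep v =
     enn2ereal (\<integral>\<^sup>+ x. ennreal (kappa p em ep (norm (weak_gradient \<Omega> v x))) \<partial>lebesgue_on \<Omega>)
     - ereal (f v)"

end

theory Submission
  imports Defs "HOL-Computational_Algebra.Polynomial"
begin

text \<open>By Young's inequality \<open>t powr p / p \<le> kappa p em ep t\<close>, so the relaxed energy dominates the energy
  \<open>J\<close>; conversely, for a test function \<open>\<phi>\<close> with bounded gradient, the relaxed energy of \<open>\<phi>\<close> exceeds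
  \<open>J \<phi>\<close> by at most \<open>em powr p / p\<close> times the measure of \<open>\<Omega>\<close> once \<open>ep\<close> is large. As test functions
  are dense, the minimizers \<open>u_eps em ep\<close> form a minimizing family for \<open>J\<close>. By coercivity their gradients
  are bounded in \<open>L\<^sup>p\<close>, uniform convexity of \<open>norm _ powr p\<close> applied to the midpoint with \<open>u\<close> gives
  convergence of the gradients, and Poincare's inequality gives convergence of the functions.

  Since the gradient in the norm is an arbitrary representative, all of this needs uniqueness of
  weak gradients almost everywhere, i.e. the fundamental lemma of the calculus of variations.\<close>

section \<open>Test functions and integration by parts\<close>

text \<open>The relaxed energy may be infinite at \<open>u\<close> and is not continuous for the
  norm of \<open>W1p0 \<Omega> p\<close>, so it is not compared with \<open>J\<close> at
  \<open>u\<close> itself. A test function whose energy is nearly that of \<open>u\<close> is fixed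
  before \<open>em\<close> and \<open>ep\<close>: for large \<open>ep\<close> its gradient never
  reaches the outer quadratic branch of \<open>kappa\<close>, and only the error of the inner branch
  remains. This is why both ends may tend to their limits independently. No weak compactness enters.
  Convergence is quantitative: closeness of \<open>J v\<close> to \<open>J u\<close> alone forces
  closeness of \<open>v\<close> to \<open>u\<close>. Uniform convexity is used in a form with an
  error \<open>\<delta> * (norm a powr p + norm b powr p)\<close>, which is harmless because the
  gradients are bounded. Estimates are made for p-th powers of norms, with the factor
  \<open>2 powr p\<close> in place of Minkowski's inequality, except where a constant close to 1 is
  essential.\<close>

lemma Ck_continuous: "Ck k \<phi> \<Longrightarrow> continuous_on UNIV \<phi>"
  by (cases k) (auto simp: continuous_on_eq_continuous_at intro: differentiable_imp_continuous_within)

lemma Ck_Suc_imp: "Ck (Suc k) \<phi> \<Longrightarrow> Ck k \<phi>"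
proof (induction k arbitrary: \<phi>)
  case 0
  then show ?case using Ck_continuous[OF 0] by simp
next
  case (Suc k)
  then show ?case by simp
qed

lemma Ck_const: "Ck k (\<lambda>x. c)"
  by (induction k arbitrary: c) auto

lemma Ck_add: "Ck k \<phi> \<Longrightarrow> Ck k \<psi> \<Longrightarrow> Ck k (\<lambda>x. \<phi> x + \<psi> x)"
proof (induction k arbitrary: \<phi> \<psi>)
  case 0
  then show ?case by (auto intro: continuous_intros)
next
  case (Suc k)
  have "frechet_derivative (\<lambda>x. \<phi> x + \<psi> x) (at x) i =
      frechet_derivative \<phi> (at x) i + frechet_derivative \<psi> (at x) i" for x i
    using Suc.prems by (simp add: fun_cong[OF frechet_derivative_at[symmetric, OF has_derivative_add,
        OF frechet_derivative_works[THEN iffD1] frechet_derivative_works[THEN iffD1]]])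
  then show ?case using Suc by simp
qed

lemma frechet_derivative_mult_real:
  fixes \<phi> \<psi> :: "'a::euclidean_space \<Rightarrow> real"
  assumes "\<phi> differentiable at x" "\<psi> differentiable at x"
  shows "frechet_derivative (\<lambda>x. \<phi> x * \<psi> x) (at x) i =
      \<phi> x * frechet_derivative \<psi> (at x) i + frechet_derivative \<phi> (at x) i * \<psi> x"
  using assms by (simp add: fun_cong[OF frechet_derivative_at[symmetric, OF has_derivative_mult,
        OF frechet_derivative_works[THEN iffD1] frechet_derivative_works[THEN iffD1]]])

lemma Ck_mult: "Ck k \<phi> \<Longrightarrow> Ck k \<psi> \<Longrightarrow> Ck k (\<lambda>x. \<phi> x * \<psi> x)"
proof (induction k arbitrary: \<phi> \<psi>)
  case 0
  then show ?case by (auto intro: continuous_intros)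
next
  case (Suc k)
  have "Ck k \<phi>" "Ck k \<psi>"
    using Suc.prems Ck_Suc_imp by blast+
  then show ?case using Suc
    by (auto simp: frechet_derivative_mult_real intro!: Ck_add)
qed

lemma Ck_prod: "(\<And>i. i \<in> I \<Longrightarrow> Ck k (\<phi> i)) \<Longrightarrow> Ck k (\<lambda>x. \<Prod>i\<in>I. \<phi> i x)"
  by (induction I rule: infinite_finite_induct) (auto intro: Ck_const Ck_mult)

lemma test_functionD:
  assumes "\<phi> \<in> test_functions \<Omega>"
  shows "Ck k \<phi>" "compact (closure {x. \<phi> x \<noteq> 0})" "closure {x. \<phi> x \<noteq> 0} \<subseteq> \<Omega>"
    "\<phi> differentiable at x" "continuous_on UNIV \<phi>"
    "i \<in> Basis \<Longrightarrow> continuous_on UNIV (\<lambda>x. frechet_derivative \<phi> (at x) i)"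
proof -
  show *: "Ck k \<phi>" for k using assms by (auto simp: test_functions_def)
  show "compact (closure {x. \<phi> x \<noteq> 0})" "closure {x. \<phi> x \<noteq> 0} \<subseteq> \<Omega>"
    using assms by (auto simp: test_functions_def)
  show "\<phi> differentiable at x" "continuous_on UNIV \<phi>"
    "i \<in> Basis \<Longrightarrow> continuous_on UNIV (\<lambda>x. frechet_derivative \<phi> (at x) i)"
    using *[of 1] *[of 0] by auto
qed

lemma test_function_linear:
  assumes "\<phi> \<in> test_functions \<Omega>" "\<psi> \<in> test_functions \<Omega>"
  shows "(\<lambda>x. a * \<phi> x + b * \<psi> x) \<in> test_functions \<Omega>"
proof -
  let ?K = "closure {x. \<phi> x \<noteq> 0} \<union> closure {x. \<psi> x \<noteq> 0}"
  have K: "compact ?K" "?K \<subseteq> \<Omega>" 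
    using compact_Un[OF test_functionD(2)[OF assms(1)] test_functionD(2)[OF assms(2)]]
      Un_least[OF test_functionD(3)[OF assms(1)] test_functionD(3)[OF assms(2)]] .
  let ?L = "closure {x. a * \<phi> x + b * \<psi> x \<noteq> 0}"
  have "{x. a * \<phi> x + b * \<psi> x \<noteq> 0} \<subseteq> {x. \<phi> x \<noteq> 0} \<union> {x. \<psi> x \<noteq> 0}" by auto
  then have L: "?L \<subseteq> ?K"
    unfolding closure_Un[symmetric] by (rule closure_mono)
  have "compact ?L"
    using compact_Int_closed[OF K(1) closed_closure, of "{x. a * \<phi> x + b * \<psi> x \<noteq> 0}"] L
    by (simp only: Int_absorb1)
  moreover have "?L \<subseteq> \<Omega>" using L K(2) by (rule subset_trans)
  moreover have "Ck k (\<lambda>x. a * \<phi> x + b * \<psi> x)" for k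
    by (intro Ck_add Ck_mult Ck_const test_functionD(1)[OF assms(1)] test_functionD(1)[OF assms(2)])
  ultimately show ?thesis by (simp add: test_functions_def)
qed

lemma off_support:
  fixes \<phi> :: "'a::euclidean_space \<Rightarrow> real"
  assumes "x \<notin> closure {x. \<phi> x \<noteq> 0}"
  shows "\<phi> x = 0" "frechet_derivative \<phi> (at x) = (\<lambda>_. 0)"
proof -
  have *: "\<phi> y = 0" if "y \<in> - closure {x. \<phi> x \<noteq> 0}" for y
  proof (rule ccontr)
    assume "\<phi> y \<noteq> 0"
    then show False using that closure_subset[of "{x. \<phi> x \<noteq> 0}"] by blast
  qed
  show "\<phi> x = 0" by (rule *[OF Compl_iff[THEN iffD2, OF assms]])
  have "((\<lambda>x. 0) has_derivative (\<lambda>_. 0)) (at x)" by simp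
  then have "(\<phi> has_derivative (\<lambda>_. 0)) (at x)"
    using open_Compl[OF closed_closure] Compl_iff[THEN iffD2, OF assms] *[symmetric]
    by (rule has_derivative_transform_within_open)
  then show "frechet_derivative \<phi> (at x) = (\<lambda>_. 0)"
    using frechet_derivative_at[symmetric] by blast
qed

section \<open>Integration of compactly supported functions and integration by parts\<close>

lemma continuous_compact_support_bounded:
  fixes g :: "'a::euclidean_space \<Rightarrow> 'b::real_normed_vector"
  assumes "continuous_on UNIV g" "compact K" "\<And>x. x \<notin> K \<Longrightarrow> g x = 0"
  obtains B where "\<And>x. norm (g x) \<le> B" "B > 0"
proof -
  have "compact (g ` K)"
    using assms compact_continuous_image continuous_on_subset by blast
  then obtain B where B: "B > 0" "\<forall>y\<in>g ` K. norm y \<le> B"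
    using compact_imp_bounded bounded_pos by metis
  have "norm (g x) \<le> B" for x
    using B assms(3)[of x] by (cases "x \<in> K") auto
  then show ?thesis using that B by auto
qed

lemma integrable_continuous_compact_support:
  fixes g :: "'a::euclidean_space \<Rightarrow> real"
  assumes "continuous_on UNIV g" "compact K" "\<And>x. x \<notin> K \<Longrightarrow> g x = 0"
  shows "integrable lborel g"
proof -
  obtain C where C: "\<And>x. norm (g x) \<le> C"
    using continuous_compact_support_bounded[OF assms] by metis
  have [measurable]: "g \<in> borel_measurable borel"
    using assms by (simp add: borel_measurable_continuous_onI)
  have "integrable lborel (\<lambda>x. C * indicator K x :: real)"
    using assms(2) by (intro integrable_mult_right integrable_real_indicator)
      (simp_all add: borel_compact emeasure_compact_finite[unfolded infinity_ennreal_def])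
  then show ?thesis
  proof (rule Bochner_Integration.integrable_bound)
    show "AE x in lborel. norm (g x) \<le> norm (C * indicator K x)"
      using C assms(3) by (intro AE_I2) (auto simp: indicator_def intro: order_trans[OF _ abs_ge_self])
  qed simp
qed

lemma lborel_integral_translate:
  fixes g :: "'a::euclidean_space \<Rightarrow> real"
  assumes "g \<in> borel_measurable borel"
  shows "integral\<^sup>L lborel (\<lambda>x. g (c + x)) = integral\<^sup>L lborel g"
proof -
  have "integral\<^sup>L lborel g = integral\<^sup>L (distr lborel borel ((+) c)) g"
    by (simp add: lborel_distr_plus)
  also have "\<dots> = integral\<^sup>L lborel (\<lambda>x. g (c + x))"
    by (rule integral_distr) (use assms in auto)
  finally show ?thesis by simp
qed

text \<open>Difference quotients of \<open>\<psi>\<close> integrate to 0 by translation invariance,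
  and the bound on the derivative together with the compact support lets dominated convergence carry
  this to the derivative. No iterated integrals are involved.\<close>

lemma integral_partial_derivative_zero:
  fixes \<psi> :: "'a::euclidean_space \<Rightarrow> real"
  assumes der: "\<And>x. (\<psi> has_derivative \<psi>' x) (at x)"
    and i: "norm i = 1"
    and B: "\<And>x. \<bar>\<psi>' x i\<bar> \<le> B"
    and K: "compact K" "\<And>x. x \<notin> K \<Longrightarrow> \<psi> x = 0"
  shows "integrable lborel (\<lambda>x. \<psi>' x i)" "integral\<^sup>L lborel (\<lambda>x. \<psi>' x i) = 0"
proof -
  have cont: "continuous_on UNIV \<psi>"
    using der by (meson continuous_at_imp_continuous_on has_derivative_continuous)
  then have [measurable]: "\<psi> \<in> borel_measurable borel"
    by (simp add: borel_measurable_continuous_onI)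
  have B0: "B \<ge> 0" using B[of 0] by linarith
  define h where "h n = 1 / real (Suc n)" for n
  have h0: "h n > 0" "h n \<le> 1" for n by (auto simp: h_def)
  have hlim: "h \<longlonglongrightarrow> 0" unfolding h_def by (rule LIMSEQ_Suc[OF lim_1_over_n])
  define D where "D n x = (\<psi> (h n *\<^sub>R i + x) - \<psi> x) / h n" for n x
  obtain R where R: "\<And>x. x \<in> K \<Longrightarrow> norm x \<le> R" "R > 0"
    using compact_imp_bounded[OF K(1)] bounded_pos by metis
  have lim: "(\<lambda>n. D n x) \<longlonglongrightarrow> \<psi>' x i" for x
  proof -
    have "((\<lambda>t. \<psi> (t *\<^sub>R i + x)) has_derivative (\<lambda>t. \<psi>' x (t *\<^sub>R i))) (at 0)"
    proof (rule has_derivative_eq_rhs[OF has_derivative_compose[where f="\<lambda>t. t *\<^sub>R i + x" and g=\<psi>]])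
      show "((\<lambda>t. t *\<^sub>R i + x) has_derivative (\<lambda>t. t *\<^sub>R i)) (at 0)"
        by (auto intro!: derivative_eq_intros)
      show "(\<psi> has_derivative \<psi>' x) (at (0 *\<^sub>R i + x))" using der by simp
    qed auto
    moreover have "\<psi>' x (t *\<^sub>R i) = \<psi>' x i * t" for t
      using has_derivative_bounded_linear[OF der[of x]] by (simp add: linear_simps)
    ultimately have "((\<lambda>t. \<psi> (t *\<^sub>R i + x)) has_field_derivative \<psi>' x i) (at 0)"
      by (simp add: has_field_derivative_def)
    then have "((\<lambda>t. (\<psi> (t *\<^sub>R i + x) - \<psi> x) / t) \<longlongrightarrow> \<psi>' x i) (at 0)"
      by (simp add: DERIV_def)
    moreover have "filterlim h (at 0) sequentially"
      using hlim h0 by (auto simp: filterlim_at less_imp_neq[symmetric] intro!: always_eventually)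
    ultimately show ?thesis unfolding D_def by (rule filterlim_compose)
  qed
  \<comment> \<open>The radius is \<open>R + 1\<close> because a shift by \<open>h n \<le> 1\<close>
    along the unit vector \<open>i\<close> cannot move a point from outside this ball into
    \<open>K\<close>.\<close>
  have bound: "\<bar>D n x\<bar> \<le> B * indicator (cball 0 (R+1)) x" for n x
  proof (cases "x \<in> cball 0 (R+1)")
    case True
    have "\<bar>\<psi> (h n *\<^sub>R i + x) - \<psi> x\<bar> \<le> B * h n"
    proof -
      have "\<exists>t\<in>{0<..<h n}. (\<psi> (h n *\<^sub>R i + x)) - \<psi> (0 *\<^sub>R i + x) = \<psi>' (t *\<^sub>R i + x) ((h n - 0) *\<^sub>R i)"
      proof (rule mvt_simple)
        fix t assume "0 \<le> t" "t \<le> h n"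
        show "((\<lambda>t. \<psi> (t *\<^sub>R i + x)) has_derivative (\<lambda>s. \<psi>' (t *\<^sub>R i + x) (s *\<^sub>R i))) (at t within {0..h n})"
        proof (rule has_derivative_eq_rhs[OF has_derivative_compose[where f="\<lambda>t. t *\<^sub>R i + x" and g=\<psi>]])
          show "((\<lambda>t. t *\<^sub>R i + x) has_derivative (\<lambda>t. t *\<^sub>R i)) (at t within {0..h n})"
            by (auto intro!: derivative_eq_intros)
          show "(\<psi> has_derivative \<psi>' (t *\<^sub>R i + x)) (at (t *\<^sub>R i + x))" using der by simp
        qed auto
      qed (use h0 in auto)
      then obtain t where "\<psi> (h n *\<^sub>R i + x) - \<psi> x = \<psi>' (t *\<^sub>R i + x) (h n *\<^sub>R i)" by auto
      also have "\<dots> = h n * \<psi>' (t *\<^sub>R i + x) i"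
        using has_derivative_bounded_linear[OF der[of "t *\<^sub>R i + x"]] by (simp add: linear_simps)
      finally show ?thesis using B[of "t *\<^sub>R i + x"] h0[of n] by (simp add: abs_mult mult.commute)
    qed
    then show ?thesis using True h0[of n] by (simp add: D_def field_simps)
  next
    case False
    then have "norm x > R + 1" by simp
    moreover have "norm (h n *\<^sub>R i + x) \<ge> norm x - norm (h n *\<^sub>R i)"
      by (smt (verit) norm_triangle_ineq4 add.commute add_diff_cancel_right')
    ultimately have "norm x > R" "norm (h n *\<^sub>R i + x) > R" using h0[of n] i by auto
    then have "x \<notin> K" "h n *\<^sub>R i + x \<notin> K" using R by force+
    then show ?thesis using False K by (simp add: D_def)
  qed
  have int: "integrable lborel (\<lambda>x. B * indicator (cball 0 (R+1)) x :: real)"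
    by (intro integrable_mult_right integrable_real_indicator)
      (simp_all add: emeasure_lborel_cball_finite[unfolded infinity_ennreal_def])
  \<comment> \<open>The derivative is not assumed continuous; it is measurable as a pointwise limit
    of difference quotients.\<close>
  have meas: "(\<lambda>x. \<psi>' x i) \<in> borel_measurable lborel"
    by (rule borel_measurable_LIMSEQ_real[OF lim]) (simp add: D_def)
  have Dm: "D n \<in> borel_measurable lborel" for n unfolding D_def by simp
  have "(\<lambda>n. integral\<^sup>L lborel (D n)) \<longlonglongrightarrow> integral\<^sup>L lborel (\<lambda>x. \<psi>' x i)"
    by (rule integral_dominated_convergence[OF meas Dm int]) (use lim bound in auto)
  moreover have "integral\<^sup>L lborel (D n) = 0" for n
  proof -
    have 1: "integrable lborel \<psi>"
      by (rule integrable_continuous_compact_support[OF cont K])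
    have "integrable (distr lborel borel ((+) (h n *\<^sub>R i))) \<psi>"
      using 1 by (simp add: lborel_distr_plus)
    then have 2: "integrable lborel (\<lambda>x. \<psi> (h n *\<^sub>R i + x))"
      by (subst (asm) integrable_distr_eq) auto
    show ?thesis
      using 1 2 lborel_integral_translate[of \<psi> "h n *\<^sub>R i"] unfolding D_def by simp
  qed
  ultimately show "integral\<^sup>L lborel (\<lambda>x. \<psi>' x i) = 0"
    by (simp add: LIMSEQ_const_iff)
  show "integrable lborel (\<lambda>x. \<psi>' x i)"
    by (rule integrable_dominated_convergence[where s=D, OF meas Dm int]) (use lim bound in auto)
qed

definition grad :: "('a::euclidean_space \<Rightarrow> real) \<Rightarrow> 'a \<Rightarrow> 'a" where
  "grad \<phi> x = (\<Sum>i\<in>Basis. frechet_derivative \<phi> (at x) i *\<^sub>R i)"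

lemma grad_inner [simp]: "i \<in> Basis \<Longrightarrow> grad \<phi> x \<bullet> i = frechet_derivative \<phi> (at x) i"
  by (simp add: grad_def)

lemma test_function_support:
  assumes "\<phi> \<in> test_functions \<Omega>"
  obtains K where "compact K" "K \<subseteq> \<Omega>" "\<And>x. x \<notin> K \<Longrightarrow> \<phi> x = 0"
    "\<And>x i. x \<notin> K \<Longrightarrow> frechet_derivative \<phi> (at x) i = 0" "\<And>x. x \<notin> K \<Longrightarrow> grad \<phi> x = 0"
proof (rule that[OF test_functionD(2)[OF assms] test_functionD(3)[OF assms]])
  fix x assume x: "x \<notin> closure {x. \<phi> x \<noteq> 0}"
  show "\<phi> x = 0" by (rule off_support(1)[OF x])
  show "frechet_derivative \<phi> (at x) i = 0" for i by (rule fun_cong[OF off_support(2)[OF x]])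
  show "grad \<phi> x = 0"
    unfolding grad_def by (subst off_support(2)[OF x]) simp
qed

lemma continuous_grad:
  "\<phi> \<in> test_functions \<Omega> \<Longrightarrow> continuous_on UNIV (grad \<phi>)"
  unfolding grad_def by (intro continuous_intros test_functionD(6))

text \<open>Translation invariance is available for \<open>lborel\<close> on the whole space. For
  functions vanishing off \<open>\<Omega>\<close> this carries its consequences over to the
  integrals on \<open>\<Omega>\<close> that occur in the definitions.\<close>

lemma integral_lebesgue_on_borel:
  fixes G :: "'a::euclidean_space \<Rightarrow> real"
  assumes "G \<in> borel_measurable borel" "open \<Omega>" "\<And>x. x \<notin> \<Omega> \<Longrightarrow> G x = 0"
  shows "integral\<^sup>L (lebesgue_on \<Omega>) G = integral\<^sup>L lborel G"
    "integrable (lebesgue_on \<Omega>) G \<longleftrightarrow> integrable lborel G"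
proof -
  have *: "(\<lambda>x. indicator \<Omega> x * G x) = G"
    using assms(3) by (auto simp: indicator_def fun_eq_iff)
  have \<Omega>: "\<Omega> \<inter> space lebesgue \<in> sets lebesgue" using assms(2) by auto
  show "integral\<^sup>L (lebesgue_on \<Omega>) G = integral\<^sup>L lborel G"
    using assms(1) by (simp add: integral_restrict_space[OF \<Omega>] * integral_completion)
  show "integrable (lebesgue_on \<Omega>) G \<longleftrightarrow> integrable lborel G"
    using assms(1) by (simp add: integrable_restrict_space[OF \<Omega>] * integrable_completion)
qed

text \<open>Integrals of non-integrable functions are 0 by convention, so the identities defining
  weak gradients can be added only once the integrals in them are known to converge. That is what
  this provides.\<close>

lemma locally_integrable_mult_continuous:
  fixes v :: "'a::euclidean_space \<Rightarrow> real"
  assumes "open \<Omega>" "locally_integrable \<Omega> v" "continuous_on UNIV \<eta>"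
    "compact K" "K \<subseteq> \<Omega>" "\<And>x. x \<notin> K \<Longrightarrow> \<eta> x = 0"
  shows "integrable (lebesgue_on \<Omega>) (\<lambda>x. v x * \<eta> x)"
proof -
  obtain B where B: "\<And>x. norm (\<eta> x) \<le> B" "B > 0"
    using continuous_compact_support_bounded assms(3,4,6) by metis
  have [measurable]: "\<eta> \<in> borel_measurable lebesgue"
    using assms(3) by (simp add: borel_measurable_continuous_onI measurable_completion)
  have "integrable (lebesgue_on K) v" using assms by (auto simp: locally_integrable_def)
  moreover have "K \<inter> space lebesgue \<in> sets lebesgue"
    using assms(4) by (auto simp: borel_compact)
  ultimately have 1: "integrable lebesgue (\<lambda>x. indicator K x *\<^sub>R v x)"
    using integrable_restrict_space by blast
  have "integrable lebesgue (\<lambda>x. (indicator K x *\<^sub>R v x) * \<eta> x)"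
  proof (rule Bochner_Integration.integrable_bound)
    show "integrable lebesgue (\<lambda>x. B * (indicator K x *\<^sub>R v x))"
      using 1 by (rule integrable_mult_right)
    show "(\<lambda>x. (indicator K x *\<^sub>R v x) * \<eta> x) \<in> borel_measurable lebesgue"
      using borel_measurable_integrable[OF 1] by measurable
    show "AE x in lebesgue. norm ((indicator K x *\<^sub>R v x) * \<eta> x) \<le> norm (B * (indicator K x *\<^sub>R v x))"
    proof (intro AE_I2)
      fix x
      have "norm (indicator K x *\<^sub>R v x) * norm (\<eta> x) \<le> norm (indicator K x *\<^sub>R v x) * B"
        by (rule mult_left_mono[OF B(1)]) simp
      then show "norm ((indicator K x *\<^sub>R v x) * \<eta> x) \<le> norm (B * (indicator K x *\<^sub>R v x))"
        using B(2) by (simp add: abs_mult mult_ac)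
    qed
  qed
  moreover have eq: "(indicator K x *\<^sub>R v x) * \<eta> x = indicator \<Omega> x *\<^sub>R (v x * \<eta> x)" for x
  proof (cases "x \<in> K")
    case True
    then show ?thesis using assms(5) by (simp add: subset_iff)
  next
    case False
    then show ?thesis using assms(6)[of x] by simp
  qed
  moreover have "\<Omega> \<inter> space lebesgue \<in> sets lebesgue" using assms(1) by auto
  ultimately show ?thesis
    by (simp only: integrable_restrict_space eq)
qed

lemma continuous_locally_integrable:
  fixes g :: "'a::euclidean_space \<Rightarrow> 'b::euclidean_space"
  assumes "continuous_on UNIV g"
  shows "locally_integrable \<Omega> g"
  unfolding locally_integrable_def
proof (intro allI impI)
  fix K :: "'a set" assume K: "compact K \<and> K \<subseteq> \<Omega>"
  then have "set_integrable lborel K g"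
    using assms by (metis borel_integrable_compact continuous_on_subset set_integrable_def subset_UNIV)
  moreover have "(\<lambda>x. indicator K x *\<^sub>R g x) \<in> borel_measurable lborel"
    using borel_measurable_continuous_onI[OF assms] K
    by (auto simp: borel_compact intro!: borel_measurable_scaleR borel_measurable_indicator)
  ultimately have "integrable lebesgue (\<lambda>x. indicator K x *\<^sub>R g x)"
    by (simp add: integrable_completion set_integrable_def)
  moreover have "K \<inter> space lebesgue \<in> sets lebesgue"
    using K by (auto simp: borel_compact)
  ultimately show "integrable (lebesgue_on K) g"
    using integrable_restrict_space by blast
qed

text \<open>The product \<open>\<phi> * \<eta>\<close> has compact support, so its partial
  derivatives have integral zero; the product rule turns this into integration by parts.\<close>

lemma test_function_has_weak_gradient:
  assumes "open \<Omega>" "\<phi> \<in> test_functions \<Omega>"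
  shows "has_weak_gradient \<Omega> \<phi> (grad \<phi>)"
  unfolding has_weak_gradient_def
proof (intro conjI ballI)
  show "locally_integrable \<Omega> \<phi>" "locally_integrable \<Omega> (grad \<phi>)"
    using assms(2) by (auto intro!: continuous_locally_integrable continuous_grad test_functionD(5))
  fix \<eta> :: "'a \<Rightarrow> real" and i :: 'a assume \<eta>: "\<eta> \<in> test_functions \<Omega>" and i: "i \<in> Basis"
  let ?d = "\<lambda>\<phi> x. frechet_derivative \<phi> (at x) i"
  note c = test_functionD(5)[OF assms(2)] test_functionD(6)[OF assms(2) i]
    test_functionD(5)[OF \<eta>] test_functionD(6)[OF \<eta> i]
  obtain K where K: "compact K" "K \<subseteq> \<Omega>"
    and z: "\<And>x. x \<notin> K \<Longrightarrow> \<phi> x = 0" "\<And>x i. x \<notin> K \<Longrightarrow> frechet_derivative \<phi> (at x) i = 0"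
    using test_function_support[OF assms(2)] by metis
  have cm: "continuous_on UNIV (\<lambda>x. \<phi> x * ?d \<eta> x)" "continuous_on UNIV (\<lambda>x. ?d \<phi> x * \<eta> x)"
    by (intro continuous_intros c)+
  have 1: "integrable lborel (\<lambda>x. \<phi> x * ?d \<eta> x)" "integrable lborel (\<lambda>x. ?d \<phi> x * \<eta> x)"
    using z by (auto intro: integrable_continuous_compact_support[OF cm(1) K(1)]
        integrable_continuous_compact_support[OF cm(2) K(1)])
  note m = borel_measurable_continuous_onI[OF cm(1)] borel_measurable_continuous_onI[OF cm(2)]
  define \<psi>' where "\<psi>' x h = \<phi> x * frechet_derivative \<eta> (at x) h + frechet_derivative \<phi> (at x) h * \<eta> x" for x h
  have "continuous_on UNIV (\<lambda>x. \<psi>' x i)" unfolding \<psi>'_def by (intro continuous_intros c)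
  then obtain B where B: "\<And>x. norm (\<psi>' x i) \<le> B"
    using continuous_compact_support_bounded[OF _ K(1), of "\<lambda>x. \<psi>' x i"]
    by (metis \<psi>'_def z add.right_neutral mult_zero_left)
  have "integral\<^sup>L lborel (\<lambda>x. \<psi>' x i) = 0"
  proof (rule integral_partial_derivative_zero(2)[where \<psi>="\<lambda>x. \<phi> x * \<eta> x", OF _ _ _ K(1)])
    show "((\<lambda>x. \<phi> x * \<eta> x) has_derivative \<psi>' x) (at x)" for x
      unfolding \<psi>'_def
      by (intro has_derivative_mult frechet_derivative_works[THEN iffD1]
          test_functionD(4)[OF assms(2)] test_functionD(4)[OF \<eta>])
  qed (use B z i in auto)
  then have "integral\<^sup>L lborel (\<lambda>x. \<phi> x * ?d \<eta> x) = - integral\<^sup>L lborel (\<lambda>x. ?d \<phi> x * \<eta> x)"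
    using 1 by (simp add: \<psi>'_def)
  moreover have "(LINT x|lebesgue_on \<Omega>. \<phi> x * ?d \<eta> x) = integral\<^sup>L lborel (\<lambda>x. \<phi> x * ?d \<eta> x)"
    by (rule integral_lebesgue_on_borel(1)[OF m(1) assms(1)]) (use z K(2) in auto)
  moreover have "(LINT x|lebesgue_on \<Omega>. ?d \<phi> x * \<eta> x) = integral\<^sup>L lborel (\<lambda>x. ?d \<phi> x * \<eta> x)"
    by (rule integral_lebesgue_on_borel(1)[OF m(2) assms(1)]) (use z K(2) in auto)
  ultimately show "(LINT x|lebesgue_on \<Omega>. \<phi> x * ?d \<eta> x) = - (LINT x|lebesgue_on \<Omega>. (grad \<phi> x \<bullet> i) * \<eta> x)"
    using i by simp
qed

section \<open>Poincare's inequality for test functions\<close>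

lemma DERIV_abs_powr:
  assumes "1 < p"
  shows "((\<lambda>s::real. \<bar>s\<bar> powr p) has_field_derivative p * \<bar>s\<bar> powr (p - 1) * sgn s) (at s)"
proof -
  consider "s > 0" | "s < 0" | "s = 0" by linarith
  then show ?thesis
  proof cases
    case 1
    have "((\<lambda>s. s powr p) has_field_derivative p * \<bar>s\<bar> powr (p - 1) * sgn s) (at s)"
      using 1 by (auto intro!: derivative_eq_intros simp: powr_diff)
    then show ?thesis
      by (rule has_field_derivative_transform_within_open[of _ _ _ "{0<..}"]) (use 1 in auto)
  next
    case 2
    have "((\<lambda>s. (- s) powr p) has_field_derivative p * \<bar>s\<bar> powr (p - 1) * sgn s) (at s)"
      using 2 by (auto intro!: derivative_eq_intros simp: powr_diff)
    then show ?thesis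
      by (rule has_field_derivative_transform_within_open[of _ _ _ "{..<0}"]) (use 2 in auto)
  next
    case 3
    have "((\<lambda>h. \<bar>h\<bar> powr (p - 1)) \<longlongrightarrow> 0) (at (0::real))"
      using assms by (intro tendsto_eq_intros | simp)+
    then have "((\<lambda>h. \<bar>h\<bar> powr p / h) \<longlongrightarrow> 0) (at (0::real))"
    proof (rule Lim_null_comparison[rotated])
      have "norm (\<bar>h\<bar> powr p / h) \<le> \<bar>h\<bar> powr (p - 1)" for h :: real
        by (cases "h = 0") (auto simp: powr_diff)
      then show "\<forall>\<^sub>F h::real in at 0. norm (\<bar>h\<bar> powr p / h) \<le> \<bar>h\<bar> powr (p - 1)" by simp
    qed
    then show ?thesis using 3 by (simp add: DERIV_def)
  qed
qed

text \<open>The partial derivative of \<open>(x \<bullet> i) * \<bar>\<phi> x\<bar> powr p\<close>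
  in direction \<open>i\<close> has integral zero. It equals
  \<open>\<bar>\<phi> x\<bar> powr p\<close> up to a term with the factor
  \<open>p * R * \<bar>\<phi> x\<bar> powr (p - 1)\<close> times the size of the partial derivative
  of \<open>\<phi>\<close>, and half of \<open>\<bar>\<phi> x\<bar> powr p\<close> absorbs the part
  of that term not controlled by the gradient.\<close>

lemma Poincare_test_function:
  fixes \<Omega> :: "'a::euclidean_space set"
  assumes "open \<Omega>" "\<And>x. x \<in> \<Omega> \<Longrightarrow> norm x \<le> R" "R > 0" "1 < p" and \<phi>: "\<phi> \<in> test_functions \<Omega>"
  shows "(LINT x|lebesgue_on \<Omega>. \<bar>\<phi> x\<bar> powr p)
      \<le> (2 * p * R) powr p * (LINT x|lebesgue_on \<Omega>. norm (grad \<phi> x) powr p)"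
proof -
  obtain i :: 'a where i: "i \<in> Basis" using nonempty_Basis by blast
  let ?d = "\<lambda>x. frechet_derivative \<phi> (at x) i"
  obtain K where K: "compact K" "K \<subseteq> \<Omega>"
    and z: "\<And>x. x \<notin> K \<Longrightarrow> \<phi> x = 0" "\<And>x. x \<notin> K \<Longrightarrow> grad \<phi> x = 0"
      "\<And>x i. x \<notin> K \<Longrightarrow> frechet_derivative \<phi> (at x) i = 0"
    using test_function_support[OF \<phi>] by metis
  note c = test_functionD(5)[OF \<phi>] test_functionD(6)[OF \<phi> i] continuous_grad[OF \<phi>]
  have cm: "continuous_on UNIV (\<lambda>x. \<bar>\<phi> x\<bar> powr p)" "continuous_on UNIV (\<lambda>x. norm (grad \<phi> x) powr p)"
    by (intro continuous_on_powr' continuous_intros c, use assms(4) in simp)+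
  have int: "integrable lborel (\<lambda>x. \<bar>\<phi> x\<bar> powr p)" "integrable lborel (\<lambda>x. norm (grad \<phi> x) powr p)"
    using z assms(4) by (auto intro: integrable_continuous_compact_support[OF cm(1) K(1)]
        integrable_continuous_compact_support[OF cm(2) K(1)])
  note m = borel_measurable_continuous_onI[OF cm(1)] borel_measurable_continuous_onI[OF cm(2)]
  \<comment> \<open>The derivative of \<open>(x \<bullet> i) * \<bar>\<phi> x\<bar> powr p\<close>
    in direction \<open>h\<close>. For \<open>h = i\<close> the last summand is exactly the quantity
    to be estimated.\<close>
  define \<psi>' where "\<psi>' x h = (x \<bullet> i) * (frechet_derivative \<phi> (at x) h * (p * \<bar>\<phi> x\<bar> powr (p - 1) * sgn (\<phi> x)))
    + (h \<bullet> i) * \<bar>\<phi> x\<bar> powr p" for x h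
  obtain A where A: "\<And>x. norm (\<phi> x) \<le> A" "A > 0"
    using continuous_compact_support_bounded[OF c(1) K(1) z(1)] by metis
  obtain D where D: "\<And>x. norm (?d x) \<le> D" "D > 0"
    using continuous_compact_support_bounded[OF c(2) K(1) z(3)] by metis
  have xi: "\<bar>x \<bullet> i\<bar> \<le> R" if "x \<in> K" for x
    using assms(2)[of x] K(2) that Basis_le_norm[OF i, of x] by auto
  have bound: "\<bar>\<psi>' x i - \<bar>\<phi> x\<bar> powr p\<bar> \<le> R * (norm (?d x) * (p * \<bar>\<phi> x\<bar> powr (p - 1)))" for x
  proof (cases "x \<in> K")
    case True
    have "\<bar>\<psi>' x i - \<bar>\<phi> x\<bar> powr p\<bar> = \<bar>x \<bullet> i\<bar> * (norm (?d x) * (p * \<bar>\<phi> x\<bar> powr (p - 1) * \<bar>sgn (\<phi> x)\<bar>))"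
      using i assms(4) by (simp add: \<psi>'_def abs_mult)
    also have "\<dots> \<le> R * (norm (?d x) * (p * \<bar>\<phi> x\<bar> powr (p - 1) * 1))"
      using xi[OF True] assms(3,4) by (intro mult_mono mult_nonneg_nonneg) (auto simp: sgn_if)
    finally show ?thesis by simp
  next
    case False
    then show ?thesis using z assms by (simp add: \<psi>'_def)
  qed
  have 1: "integrable lborel (\<lambda>x. \<psi>' x i)" "integral\<^sup>L lborel (\<lambda>x. \<psi>' x i) = 0"
  proof -
    have der: "((\<lambda>x. (x \<bullet> i) * \<bar>\<phi> x\<bar> powr p) has_derivative \<psi>' x) (at x)" for x
    proof -
      have "((\<lambda>x. \<bar>\<phi> x\<bar> powr p) has_derivative (\<lambda>h. frechet_derivative \<phi> (at x) h * (p * \<bar>\<phi> x\<bar> powr (p - 1) * sgn (\<phi> x)))) (at x)"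
        using has_derivative_compose[OF frechet_derivative_works[THEN iffD1, OF test_functionD(4)[OF \<phi>]]
            DERIV_abs_powr[OF assms(4), unfolded has_field_derivative_def]]
        by (simp add: mult.commute)
      then show ?thesis unfolding \<psi>'_def
        by (intro has_derivative_eq_rhs[OF has_derivative_mult]) (auto intro!: derivative_eq_intros)
    qed
    have B: "\<bar>\<psi>' x i\<bar> \<le> A powr p + R * (D * (p * A powr (p - 1)))" for x
    proof -
      have "\<bar>\<phi> x\<bar> powr p \<le> A powr p" using A(1)[of x] assms(4) by (intro powr_mono2) auto
      moreover have "R * (norm (?d x) * (p * \<bar>\<phi> x\<bar> powr (p - 1))) \<le> R * (D * (p * A powr (p - 1)))"
        using A(1)[of x] D assms by (intro mult_mono mult_nonneg_nonneg powr_mono2) auto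
      ultimately show ?thesis using bound[of x] by (smt (verit) powr_ge_zero)
    qed
    have "norm i = 1" using i by simp
    note * = integral_partial_derivative_zero[OF der this B K(1)]
    show "integrable lborel (\<lambda>x. \<psi>' x i)" "integral\<^sup>L lborel (\<lambda>x. \<psi>' x i) = 0"
      by (rule *; use z(1) assms(4) in simp)+
  qed
  \<comment> \<open>With \<open>t = 2 * p * R * norm (?d x)\<close>, twice the error term is
    \<open>t * \<bar>\<phi> x\<bar> powr (p - 1)\<close>. It is at most
    \<open>\<bar>\<phi> x\<bar> powr p\<close> if \<open>t \<le> \<bar>\<phi> x\<bar>\<close> and at
    most \<open>t powr p\<close> otherwise. Doubling the estimate leaves one copy of
    \<open>\<bar>\<phi> x\<bar> powr p\<close> after absorption.\<close>
  have pw: "\<bar>\<phi> x\<bar> powr p \<le> 2 * \<psi>' x i + (2 * p * R) powr p * norm (grad \<phi> x) powr p" for x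
  proof -
    have d: "norm (?d x) \<le> norm (grad \<phi> x)"
      using Basis_le_norm[OF i, of "grad \<phi> x"] i by simp
    have "2 * (R * (norm (?d x) * (p * \<bar>\<phi> x\<bar> powr (p - 1))))
        \<le> \<bar>\<phi> x\<bar> powr p + (2 * p * R) powr p * norm (grad \<phi> x) powr p"
    proof (cases "2 * p * R * norm (?d x) \<le> \<bar>\<phi> x\<bar>")
      case True
      have "2 * (R * (norm (?d x) * (p * \<bar>\<phi> x\<bar> powr (p - 1)))) = (2 * p * R * norm (?d x)) * \<bar>\<phi> x\<bar> powr (p - 1)"
        by simp
      also have "\<dots> \<le> \<bar>\<phi> x\<bar> * \<bar>\<phi> x\<bar> powr (p - 1)"
        using True by (intro mult_right_mono) auto
      also have "\<dots> = \<bar>\<phi> x\<bar> powr p" by (cases "\<phi> x = 0") (auto simp: powr_mult_base)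
      finally show ?thesis using mult_nonneg_nonneg[OF powr_ge_zero[of "2 * p * R" p] powr_ge_zero[of "norm (grad \<phi> x)" p]] by linarith
    next
      case False
      let ?t = "2 * p * R * norm (?d x)"
      have "2 * (R * (norm (?d x) * (p * \<bar>\<phi> x\<bar> powr (p - 1)))) = ?t * \<bar>\<phi> x\<bar> powr (p - 1)"
        by simp
      also have "\<dots> \<le> ?t * ?t powr (p - 1)"
        using False assms(3,4) by (intro mult_left_mono powr_mono2) auto
      also have "\<dots> = ?t powr p"
        using assms(3,4) by (subst powr_mult_base) auto
      also have "\<dots> \<le> (2 * p * R * norm (grad \<phi> x)) powr p"
        using d assms(3,4) by (intro powr_mono2 mult_left_mono) auto
      also have "\<dots> = (2 * p * R) powr p * norm (grad \<phi> x) powr p"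
        using assms(3,4) by (simp add: powr_mult)
      finally show ?thesis using powr_ge_zero[of "\<bar>\<phi> x\<bar>" p] by linarith
    qed
    then show ?thesis using bound[of x] by linarith
  qed
  have "integral\<^sup>L lborel (\<lambda>x. \<bar>\<phi> x\<bar> powr p)
      \<le> integral\<^sup>L lborel (\<lambda>x. 2 * \<psi>' x i + (2 * p * R) powr p * norm (grad \<phi> x) powr p)"
    using pw 1 int by (intro integral_mono) auto
  also have "\<dots> = (2 * p * R) powr p * integral\<^sup>L lborel (\<lambda>x. norm (grad \<phi> x) powr p)"
    using 1 int by simp
  moreover have out: "\<phi> x = 0" "grad \<phi> x = 0" if "x \<notin> \<Omega>" for x
    using that K(2) z(1,2) by blast+
  moreover have "(LINT x|lebesgue_on \<Omega>. \<bar>\<phi> x\<bar> powr p) = integral\<^sup>L lborel (\<lambda>x. \<bar>\<phi> x\<bar> powr p)"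
    by (rule integral_lebesgue_on_borel(1)[OF m(1) assms(1)]) (use assms(4) out in auto)
  moreover have "(LINT x|lebesgue_on \<Omega>. norm (grad \<phi> x) powr p) = integral\<^sup>L lborel (\<lambda>x. norm (grad \<phi> x) powr p)"
    by (rule integral_lebesgue_on_borel(1)[OF m(2) assms(1)]) (use assms(4) out in auto)
  ultimately show ?thesis by simp
qed

section \<open>Uniqueness of weak gradients\<close>

text \<open>The standard smooth function \<open>exp (- (1 / s))\<close>, extended by 0. The
  polynomial factor in \<open>1 / s\<close> makes the family closed under differentiation.\<close>

definition flat :: "real poly \<Rightarrow> real \<Rightarrow> real" where
  "flat q s = (if s > 0 then poly q (1 / s) * exp (- (1 / s)) else 0)"

lemma poly_div_exp_tendsto_0: "((\<lambda>r. poly q r * exp (- r)) \<longlongrightarrow> (0::real)) at_top"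
proof -
  have "((\<lambda>r. \<Sum>i\<le>degree q. coeff q i * (r ^ i / exp r)) \<longlongrightarrow> (\<Sum>i\<le>degree q. coeff q i * 0)) at_top"
    by (intro tendsto_sum tendsto_mult tendsto_const tendsto_power_div_exp_0)
  moreover have "(\<Sum>i\<le>degree q. coeff q i * (r ^ i / exp r)) = poly q r * exp (- r)" for r :: real
    by (simp add: poly_altdef sum_distrib_right exp_minus divide_inverse mult.assoc)
  ultimately show ?thesis by simp
qed

lemma flat_tendsto_0: "(flat q \<longlongrightarrow> 0) (at 0)"
proof -
  have "((\<lambda>s. poly q (inverse s) * exp (- inverse s)) \<longlongrightarrow> (0::real)) (at_right 0)"
    by (rule filterlim_compose[OF poly_div_exp_tendsto_0 filterlim_inverse_at_top_right])
  then have 1: "(flat q \<longlongrightarrow> 0) (at_right 0)"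
    by (rule Lim_transform_eventually)
      (auto simp: flat_def field_simps eventually_at_right_less intro!: eventually_mono[OF eventually_at_right_less[of 0]])
  have 2: "(flat q \<longlongrightarrow> 0) (at_left 0)"
    by (rule Lim_transform_eventually[OF tendsto_const])
      (auto simp: flat_def eventually_at_left_field intro!: exI[of _ "-1"])
  show ?thesis using 1 2 by (simp add: filterlim_at_split)
qed

text \<open>For \<open>s > 0\<close> the chain rule produces \<open>q - pderiv q\<close> at
  \<open>1 / s\<close> times \<open>1 / s\<close> squared, and each \<open>pCons 0\<close>
  multiplies by one factor \<open>1 / s\<close>. At 0 the difference quotient is again a member of
  the family and tends to 0.\<close>

lemma DERIV_flat:
  "(flat q has_field_derivative flat (pCons 0 (pCons 0 (q - pderiv q))) s) (at s)"
proof -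
  consider "s > 0" | "s < 0" | "s = 0" by linarith
  then show ?thesis
  proof cases
    case 1
    have "((\<lambda>s. poly q (1 / s) * exp (- (1 / s))) has_field_derivative
        flat (pCons 0 (pCons 0 (q - pderiv q))) s) (at s)"
      using 1 by (auto intro!: derivative_eq_intros DERIV_chain2[OF poly_DERIV]
          simp: flat_def field_simps power2_eq_square)
    then show ?thesis
      by (rule has_field_derivative_transform_within_open[of _ _ _ "{0<..}"]) (use 1 in \<open>auto simp: flat_def\<close>)
  next
    case 2
    have "((\<lambda>s. 0) has_field_derivative flat (pCons 0 (pCons 0 (q - pderiv q))) s) (at s)"
      using 2 by (simp add: flat_def)
    then show ?thesis
      by (rule has_field_derivative_transform_within_open[of _ _ _ "{..<0}"]) (use 2 in \<open>auto simp: flat_def\<close>)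
  next
    case 3
    have "flat q h / h = flat (pCons 0 q) h" for h
      by (simp add: flat_def)
    then show ?thesis
      using flat_tendsto_0[of "pCons 0 q"] 3 by (simp add: DERIV_def flat_def[of _ 0])
  qed
qed

text \<open>Differentiation replaces \<open>q\<close> by another polynomial and contributes a
  constant factor, hence the induction for all \<open>q\<close> at once. Affine arguments cover the
  factors of a bump at lower and at upper faces of a box.\<close>

lemma Ck_flat_affine: "Ck k (\<lambda>x::'a::euclidean_space. flat q (c + x \<bullet> w))"
proof (induction k arbitrary: q)
  case 0
  have "continuous_on UNIV (flat q)"
    using DERIV_flat by (meson DERIV_isCont continuous_at_imp_continuous_on)
  then show ?case
    by (auto intro!: continuous_on_compose2[of UNIV "flat q"] continuous_intros)
next
  case (Suc k)
  define q' where "q' = pCons 0 (pCons 0 (q - pderiv q))"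
  have d: "((\<lambda>x::'a. flat q (c + x \<bullet> w)) has_derivative (\<lambda>h. flat q' (c + x \<bullet> w) * (h \<bullet> w))) (at x)" for x
    by (rule has_derivative_eq_rhs[OF has_derivative_compose[where g="flat q" and f="\<lambda>x. c + x \<bullet> w",
        OF _ DERIV_flat[unfolded has_field_derivative_def]]])
      (auto intro!: derivative_eq_intros simp: q'_def)
  then show ?case
    using Suc[of q'] by (auto simp: frechet_derivative_at[OF d, symmetric] differentiable_def
        intro!: Ck_mult Ck_const)
qed

lemma flat_1: "flat [:1:] s = (if s > 0 then exp (- (1 / s)) else 0)"
  by (simp add: flat_def)

text \<open>Since \<open>exp (- 1 / (n * s))\<close> tends to \<open>1\<close> for \<open>s > 0\<close>, these functions converge to the
  indicator of the box as \<open>n\<close> grows, with support in the fixed box.\<close>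

definition box_bump :: "'a::euclidean_space \<Rightarrow> 'a \<Rightarrow> nat \<Rightarrow> 'a \<Rightarrow> real" where
  "box_bump a b n x = (\<Prod>i\<in>Basis. flat [:1:] (real n * ((x - a) \<bullet> i)) * flat [:1:] (real n * ((b - x) \<bullet> i)))"

lemma box_bump_bounds: "0 \<le> box_bump a b n x" "box_bump a b n x \<le> 1"
  unfolding box_bump_def
  by (auto intro!: prod_nonneg prod_le_1 mult_le_one simp: flat_1)

lemma box_bump_off: "x \<notin> box a b \<Longrightarrow> box_bump a b n x = 0"
  unfolding box_bump_def mem_box
  by (rule prod_zero) (auto simp: flat_1 inner_diff_left zero_less_mult_iff)

lemma box_bump_tendsto: "(\<lambda>n. box_bump a b n x) \<longlonglongrightarrow> indicator (box a b) x"
proof (cases "x \<in> box a b")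
  case True
  have *: "(\<lambda>n. flat [:1:] (real n * s)) \<longlonglongrightarrow> 1" if "s > 0" for s
  proof -
    have "(\<lambda>n. exp (- (1 / (real n * s)))) \<longlonglongrightarrow> exp (- (1 / s * 0))"
      using tendsto_mult[OF tendsto_const lim_1_over_n, of "1 / s"]
      by (intro tendsto_intros) (simp add: field_simps)
    then have "(\<lambda>n. exp (- (1 / (real n * s)))) \<longlonglongrightarrow> 1" by simp
    then show ?thesis
      by (rule Lim_transform_eventually)
        (use that in \<open>auto simp: flat_1 intro!: eventually_mono[OF eventually_gt_at_top[of 0]]\<close>)
  qed
  have "(\<lambda>n. box_bump a b n x) \<longlonglongrightarrow> (\<Prod>i\<in>(Basis::'a set). 1 * 1)"
    unfolding box_bump_def
    using True by (intro tendsto_prod tendsto_mult *) (auto simp: mem_box inner_diff_left)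
  then show ?thesis using True by simp
next
  case False
  then show ?thesis by (simp add: box_bump_off)
qed

lemma box_bump_test_function:
  assumes "cbox a b \<subseteq> \<Omega>"
  shows "box_bump a b n \<in> test_functions \<Omega>"
proof -
  have "Ck k (box_bump a b n)" for k
  proof -
    have "box_bump a b n = (\<lambda>x. \<Prod>i\<in>Basis. flat [:1:] (- real n * (a \<bullet> i) + x \<bullet> (real n *\<^sub>R i)) *
        flat [:1:] (real n * (b \<bullet> i) + x \<bullet> (- real n *\<^sub>R i)))"
      by (auto simp: box_bump_def fun_eq_iff inner_diff_left algebra_simps)
    then show ?thesis by (simp only:) (intro Ck_prod Ck_mult Ck_flat_affine)
  qed
  moreover have sub: "closure {x. box_bump a b n x \<noteq> 0} \<subseteq> cbox a b"
    by (rule closure_minimal) (use box_bump_off[of _ a b n] box_subset_cbox[of a b] in auto)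
  moreover have "compact (closure {x. box_bump a b n x \<noteq> 0})"
    using compact_Int_closed[OF compact_cbox closed_closure] sub by (metis inf.absorb_iff2)
  ultimately show ?thesis using assms unfolding test_functions_def by blast
qed

section \<open>The fundamental lemma of the calculus of variations\<close>

text \<open>Open boxes are stable under intersection and generate the Borel sets, so a Dynkin
  argument extends the vanishing of the integrals from boxes to all Borel sets.\<close>

lemma lborel_AE_zero_if_box_integrals_zero:
  fixes G :: "'a::euclidean_space \<Rightarrow> real"
  assumes int: "integrable lborel G" and box0: "\<And>a b. (LINT x:box a b|lborel. G x) = 0"
  shows "AE x in lborel. G x = 0"
proof (rule sigma_finite_measure.density_zero[OF sigma_finite_lborel int])
  fix A :: "'a set" assume "A \<in> sets lborel"
  then have A: "A \<in> sigma_sets UNIV (range (\<lambda>(a, b). box a b :: 'a set))"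
    by (simp add: borel_eq_box)
  \<comment> \<open>The complement case of the induction needs the integral over the whole space; it
    is the limit over an increasing sequence of boxes.\<close>
  have tot: "integral\<^sup>L lborel G = 0"
  proof -
    define B where "B n = box (- real n *\<^sub>R One) (real n *\<^sub>R One :: 'a)" for n
    have inc: "incseq B"
      unfolding incseq_def B_def by (auto simp: mem_box) (smt (verit) of_nat_mono)+
    have U: "(\<Union>n. B n) = UNIV"
    proof -
      have "\<exists>n. x \<in> B n" for x
      proof -
        obtain n where "norm x < real n" using reals_Archimedean2 by blast
        then have "\<bar>x \<bullet> i\<bar> < real n" if "i \<in> Basis" for i
          using Basis_le_norm[OF that, of x] by linarith
        then have "x \<in> B n" by (force simp: B_def mem_box abs_less_iff)
        then show ?thesis by blast
      qed
      then show ?thesis by blast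
    qed
    have "(\<lambda>n. LINT x:B n|lborel. G x) \<longlonglongrightarrow> (LINT x:(\<Union>n. B n)|lborel. G x)"
      by (rule set_integral_cont_up[OF _ inc]) (use int U in \<open>simp_all add: B_def set_integrable_def\<close>)
    moreover have "(LINT x:B n|lborel. G x) = 0" for n by (simp add: B_def box0)
    moreover have "(LINT x:(\<Union>n. B n)|lborel. G x) = integral\<^sup>L lborel G"
      unfolding U by (simp add: set_lebesgue_integral_def)
    ultimately show ?thesis by (simp add: LIMSEQ_const_iff)
  qed
  have sets: "A \<in> sets lborel" if "A \<in> sigma_sets UNIV (range (\<lambda>(a, b). box a b :: 'a set))" for A
    using that by (simp add: borel_eq_box)
  have si: "set_integrable lborel A G" if "A \<in> sets lborel" for A
    unfolding set_integrable_def using that int by (rule integrable_mult_indicator)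
  show "(LINT x:A|lborel. G x) = 0"
    using _ _ A
  proof (rule sigma_sets_induct_disjoint)
    show "Int_stable (range (\<lambda>(a, b). box a b :: 'a set))"
      by (auto simp: Int_stable_def Int_interval box_Int_box)
    show "(LINT x:A|lborel. G x) = 0" if "A \<in> range (\<lambda>(a, b). box a b)" for A
      using that box0 by auto
    show "(LINT x:UNIV - A|lborel. G x) = 0"
      if A: "A \<in> sigma_sets UNIV (range (\<lambda>(a, b). box a b))" "(LINT x:A|lborel. G x) = 0" for A
    proof -
      have "(LINT x:A \<union> (UNIV - A)|lborel. G x) = (LINT x:A|lborel. G x) + (LINT x:UNIV - A|lborel. G x)"
        using sets[OF A(1)] by (intro set_integral_Un si) auto
      then show ?thesis using A(2) tot by (simp add: set_lebesgue_integral_def)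
    qed
    show "(LINT x:(\<Union>i. A i)|lborel. G x) = 0"
      if "disjoint_family A" "range A \<subseteq> sigma_sets UNIV (range (\<lambda>(a, b). box a b))"
        "\<And>i. (LINT x:A i|lborel. G x) = 0" for A :: "nat \<Rightarrow> 'a set"
    proof -
      have Ai: "A i \<in> sets lborel" for i using that(2) sets by blast
      have "(LINT x:(\<Union>i. A i)|lborel. G x) = (\<Sum>i. LINT x:A i|lborel. G x)"
        by (rule lebesgue_integral_countable_add) (use Ai that(1) si in \<open>auto simp: disjoint_family_on_def\<close>)
      then show ?thesis using that(3) by simp
    qed
  qed (auto simp: set_lebesgue_integral_def)
qed

text \<open>Inside a closed box contained in \<open>\<Omega>\<close> the function \<open>h\<close>
  is integrable, and bumps converging to indicators show that its integrals over all smaller boxes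
  vanish. Countably many such boxes cover \<open>\<Omega>\<close>.\<close>

lemma fundamental_lemma_calculus_of_variations:
  fixes h :: "'a::euclidean_space \<Rightarrow> real"
  assumes \<Omega>: "open \<Omega>" and h: "locally_integrable \<Omega> h"
    and zero: "\<And>\<phi>. \<phi> \<in> test_functions \<Omega> \<Longrightarrow> (LINT x|lebesgue_on \<Omega>. h x * \<phi> x) = 0"
  shows "AE x in lebesgue_on \<Omega>. h x = 0"
proof -
  have box: "AE x in lebesgue. x \<in> box a b \<longrightarrow> h x = 0" if ab: "cbox a b \<subseteq> \<Omega>" for a b
  proof -
    have "cbox a b \<inter> space lebesgue \<in> sets lebesgue" by auto
    then have ih: "integrable lebesgue (\<lambda>x. indicator (cbox a b) x *\<^sub>R h x)"
      using h[unfolded locally_integrable_def, rule_format, of "cbox a b"] ab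
      by (simp add: integrable_restrict_space)
    define H where "H x = indicator (box a b) x * h x" for x
    have "integrable lebesgue (\<lambda>x. indicator (box a b) x *\<^sub>R (indicator (cbox a b) x *\<^sub>R h x))"
      by (rule integrable_mult_indicator[OF _ ih]) auto
    moreover have "(\<lambda>x. indicator (box a b) x *\<^sub>R (indicator (cbox a b) x *\<^sub>R h x)) = H"
      using box_subset_cbox[of a b] by (auto simp: H_def fun_eq_iff indicator_def)
    ultimately have iH: "integrable lebesgue H" by simp
    \<comment> \<open>\<open>h\<close> is only Lebesgue measurable, whereas the Dynkin argument is
      about \<open>lborel\<close>; a Borel representative \<open>G\<close> bridges the two.\<close>
    then obtain G where G: "G \<in> borel_measurable lborel" "AE x in lborel. H x = G x"
      using completion_ex_borel_measurable_real[of H lborel] by auto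
    have GH: "AE x in lebesgue. H x = G x" using G(2) by (rule AE_completion)
    have G': "G \<in> borel_measurable lebesgue" using G(1) by (rule measurable_completion)
    have "integrable lebesgue G"
      using integrable_cong_AE[OF _ G' GH] iH by auto
    then have iG: "integrable lborel G" using G(1) by (simp add: integrable_completion)
    \<comment> \<open>All bumps live in the fixed box \<open>cbox a b\<close>, so the absolute value
      of \<open>h\<close> on that box is an integrable majorant.\<close>
    have sub0: "(LINT x|lebesgue. indicator (box c d) x * h x) = 0" if cd: "cbox c d \<subseteq> cbox a b" for c d
    proof -
      have "(\<lambda>n. LINT x|lebesgue. box_bump c d n x * (indicator (cbox a b) x * h x)) \<longlonglongrightarrow>
         (LINT x|lebesgue. indicator (box c d) x * (indicator (cbox a b) x * h x))"
      proof (rule integral_dominated_convergence)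
        show "integrable lebesgue (\<lambda>x. norm (indicator (cbox a b) x * h x))"
          using ih by simp
        have m: "(\<lambda>x. indicator (cbox a b) x * h x) \<in> borel_measurable lebesgue"
          using ih by (simp add: borel_measurable_integrable)
        show "(\<lambda>x. indicator (box c d) x * (indicator (cbox a b) x * h x)) \<in> borel_measurable lebesgue"
          by (intro borel_measurable_times[OF _ m] borel_measurable_indicator) simp
        have "box_bump c d n \<in> borel_measurable borel" for n
          using test_functionD(5)[OF box_bump_test_function[OF order_refl]] by (rule borel_measurable_continuous_onI)
        then show "(\<lambda>x. box_bump c d n x * (indicator (cbox a b) x * h x)) \<in> borel_measurable lebesgue" for n
          by (intro borel_measurable_times[OF _ m] measurable_completion) simp
        show "AE x in lebesgue. (\<lambda>n. box_bump c d n x * (indicator (cbox a b) x * h x))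
            \<longlonglongrightarrow> indicator (box c d) x * (indicator (cbox a b) x * h x)"
          by (intro AE_I2 tendsto_mult box_bump_tendsto tendsto_const)
        show "AE x in lebesgue. norm (box_bump c d n x * (indicator (cbox a b) x * h x))
            \<le> norm (indicator (cbox a b) x * h x)" for n
          using box_bump_bounds[of c d n] 
          by (intro AE_I2) (auto simp: abs_mult intro!: mult_left_le_one_le)
      qed
      moreover have "(LINT x|lebesgue. box_bump c d n x * (indicator (cbox a b) x * h x)) = 0" for n
      proof -
        have A: "(LINT x|lebesgue_on \<Omega>. h x * box_bump c d n x) = 0"
          using cd ab by (intro zero box_bump_test_function) auto
        have B: "(LINT x|lebesgue_on \<Omega>. h x * box_bump c d n x)
            = (LINT x|lebesgue. indicator \<Omega> x *\<^sub>R (h x * box_bump c d n x))"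
          using \<Omega> by (intro integral_restrict_space) auto
        have eq: "indicator \<Omega> x *\<^sub>R (h x * box_bump c d n x) = box_bump c d n x * (indicator (cbox a b) x * h x)" for x
          using cd ab box_subset_cbox[of c d] box_bump_off[of x c d n]
          by (cases "x \<in> box c d") (auto simp: indicator_def)
        show ?thesis using A B unfolding eq by simp
      qed
      moreover have "indicator (box c d) x * (indicator (cbox a b) x * h x) = indicator (box c d) x * h x" for x
        using cd box_subset_cbox[of c d] by (auto simp: indicator_def)
      ultimately show ?thesis by (simp add: LIMSEQ_const_iff)
    qed
    have "AE x in lborel. G x = 0"
    proof (rule lborel_AE_zero_if_box_integrals_zero[OF iG])
      fix c d :: 'a
      obtain c' d' where cd': "box c d \<inter> box a b = box c' d'" using box_Int_box by blast
      have "(LINT x:box c d|lborel. G x) = (LINT x|lebesgue. indicator (box c d) x * G x)"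
        unfolding set_lebesgue_integral_def using G(1) by (subst integral_completion) auto
      also have "\<dots> = (LINT x|lebesgue. indicator (box c d) x * H x)"
        using GH by (intro integral_cong_AE borel_measurable_times borel_measurable_indicator G'
            borel_measurable_integrable[OF iH]) auto
      also have "\<dots> = (LINT x|lebesgue. indicator (box c' d') x * h x)"
        by (simp add: cd'[symmetric] H_def indicator_inter_arith mult.assoc)
      also have "\<dots> = 0"
      \<comment> \<open>If the open box is empty, \<open>cbox c' d'\<close> can still be nonempty
        and leave \<open>cbox a b\<close>. Only for a nonempty open box is the closed one its
        closure.\<close>
      proof (cases "box c' d' = {}")
        case False
        then have "cbox c' d' = closure (box c' d')" by (simp add: closure_box)
        also have "\<dots> \<subseteq> cbox a b" using cd' box_subset_cbox[of a b] by (intro closure_minimal) auto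
        finally show ?thesis by (rule sub0)
      qed simp
      finally show "(LINT x:box c d|lborel. G x) = 0" .
    qed
    then have "AE x in lebesgue. G x = 0" by (rule AE_completion)
    then show ?thesis
      using GH by eventually_elim (auto simp: H_def indicator_def)
  qed
  \<comment> \<open>\<open>\<Omega>\<close> is a countable union of closed boxes, not of the open
    ones treated so far; the faces are null sets.\<close>
  have cbox: "AE x in lebesgue. x \<in> cbox a b \<longrightarrow> h x = 0" if "cbox a b \<subseteq> \<Omega>" for a b
  proof -
    have "cbox a b - box a b \<in> null_sets lebesgue"
      using negligible_frontier_interval negligible_iff_null_sets by blast
    from AE_not_in[OF this] box[OF that] show ?thesis
      by eventually_elim auto
  qed
  obtain \<D> where D: "countable \<D>" "\<D> \<subseteq> Pow \<Omega>" "\<And>X. X \<in> \<D> \<Longrightarrow> \<exists>a b. X = cbox a b" "\<Union>\<D> = \<Omega>"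
    using open_countable_Union_open_cbox[OF \<Omega>] by metis
  have "AE x in lebesgue. \<forall>X\<in>\<D>. x \<in> X \<longrightarrow> h x = 0"
    using D(2,3) cbox by (subst AE_ball_countable[OF D(1)]) blast
  then have "AE x in lebesgue. x \<in> \<Omega> \<longrightarrow> h x = 0"
    by eventually_elim (use D(4) in blast)
  then show ?thesis
    using \<Omega> by (simp add: AE_restrict_space_iff)
qed

section \<open>The space of Sobolev functions with zero boundary values\<close>

lemma norm_add_powr_le:
  fixes a b :: "'b::real_normed_vector"
  assumes "1 < p"
  shows "norm (a + b) powr p \<le> 2 powr p * (norm a powr p + norm b powr p)"
proof -
  let ?m = "max (norm a) (norm b)"
  have "norm (a + b) \<le> 2 * ?m" using norm_triangle_ineq[of a b] by linarith
  then have "norm (a + b) powr p \<le> (2 * ?m) powr p" using assms by (intro powr_mono2) auto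
  also have "\<dots> = 2 powr p * ?m powr p" by (rule powr_mult) 
  also have "\<dots> \<le> 2 powr p * (norm a powr p + norm b powr p)"
    by (intro mult_left_mono) (auto simp: max_def)
  finally show ?thesis .
qed

locale sobolev_domain =
  fixes \<Omega> :: "'a::euclidean_space set" and p :: real
  assumes open_domain: "open \<Omega>" and bounded_domain: "bounded \<Omega>" and p_gt_1: "1 < p"
begin

abbreviation wg :: "('a \<Rightarrow> real) \<Rightarrow> 'a \<Rightarrow> 'a" where "wg \<equiv> weak_gradient \<Omega>"

text \<open>The p-th power of the \<open>Lp\<close> seminorm, for scalar functions and gradients
  alike.\<close>

definition pint :: "('a \<Rightarrow> 'b::euclidean_space) \<Rightarrow> real" where
  "pint g = (LINT x|lebesgue_on \<Omega>. norm (g x) powr p)"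

lemma domain_sets: "\<Omega> \<in> sets lebesgue" "\<Omega> \<inter> space lebesgue \<in> sets lebesgue"
  using open_domain by auto

lemma finite_measure_domain: "finite_measure (lebesgue_on \<Omega>)"
  by (rule finite_measure_lebesgue_on) (use bounded_domain open_domain in \<open>simp add: lmeasurable_open\<close>)

lemma pint_nonneg: "0 \<le> pint g"
  unfolding pint_def by (rule Bochner_Integration.integral_nonneg_AE) simp

lemma LpD: "g \<in> Lp \<Omega> p \<Longrightarrow> g \<in> borel_measurable (lebesgue_on \<Omega>)"
  "g \<in> Lp \<Omega> p \<Longrightarrow> integrable (lebesgue_on \<Omega>) (\<lambda>x. norm (g x) powr p)"
  by (auto simp: Lp_def)

text \<open>Lebesgue measure is complete, so changes on null sets preserve measurability; extension
  by 0 off \<open>\<Omega>\<close> reduces this to the whole space.\<close>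

lemma measurable_AE_eq:
  fixes g h :: "'a \<Rightarrow> 'b::euclidean_space"
  assumes "g \<in> borel_measurable (lebesgue_on \<Omega>)" "AE x in lebesgue_on \<Omega>. g x = h x"
  shows "h \<in> borel_measurable (lebesgue_on \<Omega>)"
proof -
  have "AE x in lebesgue. x \<in> \<Omega> \<longrightarrow> g x = h x"
    using assms(2) by (simp add: AE_restrict_space_iff domain_sets)
  then have "AE x in lebesgue. (if x \<in> \<Omega> then g x else 0) = (if x \<in> \<Omega> then h x else 0)"
    by eventually_elim auto
  from borel_measurable_AE[OF borel_measurable_if_I[OF assms(1) domain_sets(1)] this] show ?thesis
    by (rule borel_measurable_if_D)
qed

lemma Lp_AE_eq:
  fixes g h :: "'a \<Rightarrow> 'b::euclidean_space"
  assumes "g \<in> Lp \<Omega> p" "AE x in lebesgue_on \<Omega>. g x = h x"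
  shows "h \<in> Lp \<Omega> p"
proof -
  have [measurable]: "g \<in> borel_measurable (lebesgue_on \<Omega>)" "h \<in> borel_measurable (lebesgue_on \<Omega>)"
    using measurable_AE_eq[OF _ assms(2)] LpD[OF assms(1)] by auto
  have "AE x in lebesgue_on \<Omega>. norm (g x) powr p = norm (h x) powr p"
    using assms(2) by eventually_elim simp
  from integrable_cong_AE[OF _ _ this]
  have "integrable (lebesgue_on \<Omega>) (\<lambda>x. norm (h x) powr p)"
    using LpD(2)[OF assms(1)] by simp
  then show ?thesis by (simp add: Lp_def)
qed

lemma pint_AE_eq:
  fixes g h :: "'a \<Rightarrow> 'b::euclidean_space"
  assumes "g \<in> Lp \<Omega> p" "AE x in lebesgue_on \<Omega>. g x = h x"
  shows "pint g = pint h"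
  unfolding pint_def
proof (rule integral_cong_AE)
  show "AE x in lebesgue_on \<Omega>. norm (g x) powr p = norm (h x) powr p"
    using assms(2) by eventually_elim simp
qed (use LpD(2)[OF assms(1)] LpD(2)[OF Lp_AE_eq[OF assms]] in auto)

lemma pint_linear:
  fixes g h :: "'a \<Rightarrow> 'b::euclidean_space"
  assumes "g \<in> Lp \<Omega> p" "h \<in> Lp \<Omega> p"
  shows "(\<lambda>x. a *\<^sub>R g x + b *\<^sub>R h x) \<in> Lp \<Omega> p"
    "pint (\<lambda>x. a *\<^sub>R g x + b *\<^sub>R h x) \<le> 2 powr p * (\<bar>a\<bar> powr p * pint g + \<bar>b\<bar> powr p * pint h)"
proof -
  have [measurable]: "g \<in> borel_measurable (lebesgue_on \<Omega>)" "h \<in> borel_measurable (lebesgue_on \<Omega>)"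
    using LpD assms by auto
  let ?B = "\<lambda>x. 2 powr p * (\<bar>a\<bar> powr p * norm (g x) powr p + \<bar>b\<bar> powr p * norm (h x) powr p)"
  have le: "norm (a *\<^sub>R g x + b *\<^sub>R h x) powr p \<le> ?B x" for x
    using norm_add_powr_le[OF p_gt_1, of "a *\<^sub>R g x" "b *\<^sub>R h x"] by (simp add: powr_mult)
  have int: "integrable (lebesgue_on \<Omega>) ?B" using LpD(2)[OF assms(1)] LpD(2)[OF assms(2)] by simp
  have int': "integrable (lebesgue_on \<Omega>) (\<lambda>x. norm (a *\<^sub>R g x + b *\<^sub>R h x) powr p)"
    using int
  proof (rule Bochner_Integration.integrable_bound)
    show "AE x in lebesgue_on \<Omega>. norm (norm (a *\<^sub>R g x + b *\<^sub>R h x) powr p) \<le> norm (?B x)"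
      using le by (intro AE_I2) (simp add: order_trans[OF le abs_ge_self])
  qed measurable
  then show "(\<lambda>x. a *\<^sub>R g x + b *\<^sub>R h x) \<in> Lp \<Omega> p" by (simp add: Lp_def)
  have "pint (\<lambda>x. a *\<^sub>R g x + b *\<^sub>R h x) \<le> integral\<^sup>L (lebesgue_on \<Omega>) ?B"
    unfolding pint_def using int' int le by (intro integral_mono) auto
  also have "\<dots> = 2 powr p * (\<bar>a\<bar> powr p * pint g + \<bar>b\<bar> powr p * pint h)"
    unfolding pint_def using LpD(2)[OF assms(1)] LpD(2)[OF assms(2)] by simp
  finally show "pint (\<lambda>x. a *\<^sub>R g x + b *\<^sub>R h x) \<le> 2 powr p * (\<bar>a\<bar> powr p * pint g + \<bar>b\<bar> powr p * pint h)" .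
qed

lemma locally_integrable_linear:
  fixes g h :: "'a \<Rightarrow> 'b::euclidean_space"
  assumes "locally_integrable \<Omega> g" "locally_integrable \<Omega> h"
  shows "locally_integrable \<Omega> (\<lambda>x. a *\<^sub>R g x + b *\<^sub>R h x)"
  using assms unfolding locally_integrable_def by auto

lemma locally_integrable_inner:
  "locally_integrable \<Omega> g \<Longrightarrow> locally_integrable \<Omega> (\<lambda>x. g x \<bullet> i)"
  unfolding locally_integrable_def by auto

lemma integrable_mult_test_function:
  fixes v :: "'a \<Rightarrow> real"
  assumes "locally_integrable \<Omega> v" "\<phi> \<in> test_functions \<Omega>"
  shows "integrable (lebesgue_on \<Omega>) (\<lambda>x. v x * \<phi> x)"
    "i \<in> Basis \<Longrightarrow> integrable (lebesgue_on \<Omega>) (\<lambda>x. v x * frechet_derivative \<phi> (at x) i)"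
proof -
  obtain K where K: "compact K" "K \<subseteq> \<Omega>" "\<And>x. x \<notin> K \<Longrightarrow> \<phi> x = 0"
    "\<And>x i. x \<notin> K \<Longrightarrow> frechet_derivative \<phi> (at x) i = 0"
    using test_function_support[OF assms(2)] by metis
  show "integrable (lebesgue_on \<Omega>) (\<lambda>x. v x * \<phi> x)"
    by (rule locally_integrable_mult_continuous[OF open_domain assms(1) test_functionD(5)[OF assms(2)] K(1-3)])
  show "i \<in> Basis \<Longrightarrow> integrable (lebesgue_on \<Omega>) (\<lambda>x. v x * frechet_derivative \<phi> (at x) i)"
    by (rule locally_integrable_mult_continuous[OF open_domain assms(1) test_functionD(6)[OF assms(2)] K(1,2,4)])
qed

lemma has_weak_gradient_linear:
  assumes "has_weak_gradient \<Omega> v g" "has_weak_gradient \<Omega> w h"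
  shows "has_weak_gradient \<Omega> (\<lambda>x. a * v x + b * w x) (\<lambda>x. a *\<^sub>R g x + b *\<^sub>R h x)"
proof -
  have l: "locally_integrable \<Omega> v" "locally_integrable \<Omega> w" "locally_integrable \<Omega> g" "locally_integrable \<Omega> h"
    using assms by (auto simp: has_weak_gradient_def)
  show ?thesis
    unfolding has_weak_gradient_def
  proof (intro conjI ballI)
    show "locally_integrable \<Omega> (\<lambda>x. a * v x + b * w x)" "locally_integrable \<Omega> (\<lambda>x. a *\<^sub>R g x + b *\<^sub>R h x)"
      using locally_integrable_linear[OF l(1,2)] locally_integrable_linear[OF l(3,4)] by simp_all
    fix \<phi> and i :: 'a assume \<phi>: "\<phi> \<in> test_functions \<Omega>" and i: "i \<in> Basis"
    let ?d = "\<lambda>x. frechet_derivative \<phi> (at x) i"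
    have "(LINT x|lebesgue_on \<Omega>. (a * v x + b * w x) * ?d x)
        = a * (LINT x|lebesgue_on \<Omega>. v x * ?d x) + b * (LINT x|lebesgue_on \<Omega>. w x * ?d x)"
      using integrable_mult_test_function(2)[OF l(1) \<phi> i] integrable_mult_test_function(2)[OF l(2) \<phi> i]
      by (simp add: distrib_right mult.assoc)
    also have "\<dots> = - (a * (LINT x|lebesgue_on \<Omega>. (g x \<bullet> i) * \<phi> x) + b * (LINT x|lebesgue_on \<Omega>. (h x \<bullet> i) * \<phi> x))"
      using assms \<phi> i by (simp add: has_weak_gradient_def)
    also have "\<dots> = - (LINT x|lebesgue_on \<Omega>. ((a *\<^sub>R g x + b *\<^sub>R h x) \<bullet> i) * \<phi> x)"
      using integrable_mult_test_function(1)[OF locally_integrable_inner[OF l(3)] \<phi>, of i]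
        integrable_mult_test_function(1)[OF locally_integrable_inner[OF l(4)] \<phi>, of i]
      by (simp add: inner_add_left distrib_right mult.assoc)
    finally show "(LINT x|lebesgue_on \<Omega>. (a * v x + b * w x) * ?d x) =
        - (LINT x|lebesgue_on \<Omega>. ((a *\<^sub>R g x + b *\<^sub>R h x) \<bullet> i) * \<phi> x)" .
  qed
qed

text \<open>By linearity \<open>g - h\<close> is a weak gradient of the zero function, so each of
  its components integrates to 0 against every test function.\<close>

lemma weak_gradient_unique:
  assumes "has_weak_gradient \<Omega> v g" "has_weak_gradient \<Omega> v h"
  shows "AE x in lebesgue_on \<Omega>. g x = h x"
proof -
  have "AE x in lebesgue_on \<Omega>. (g x - h x) \<bullet> i = 0" if i: "i \<in> Basis" for i
  proof (rule fundamental_lemma_calculus_of_variations[OF open_domain])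
    have d: "has_weak_gradient \<Omega> (\<lambda>x. 1 * v x + (-1) * v x) (\<lambda>x. 1 *\<^sub>R g x + (-1) *\<^sub>R h x)"
      by (rule has_weak_gradient_linear[OF assms])
    then show "locally_integrable \<Omega> (\<lambda>x. (g x - h x) \<bullet> i)"
      using locally_integrable_inner[of "\<lambda>x. g x - h x"] by (simp add: has_weak_gradient_def)
    show "(LINT x|lebesgue_on \<Omega>. ((g x - h x) \<bullet> i) * \<phi> x) = 0" if "\<phi> \<in> test_functions \<Omega>" for \<phi>
      using d that i by (auto simp: has_weak_gradient_def)
  qed
  then have "AE x in lebesgue_on \<Omega>. \<forall>i\<in>Basis. (g x - h x) \<bullet> i = 0"
    by (intro AE_finite_allI) auto
  then show ?thesis
    by eventually_elim (metis euclidean_all_zero_iff eq_iff_diff_eq_0)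
qed

text \<open>The representative chosen by \<open>weak_gradient\<close> is any weak gradient, not
  necessarily the p-integrable one from \<open>W1p\<close>; uniqueness transfers the
  integrability.\<close>

lemma W1pD:
  assumes "v \<in> W1p \<Omega> p"
  shows "v \<in> Lp \<Omega> p" "has_weak_gradient \<Omega> v (wg v)" "wg v \<in> Lp \<Omega> p"
proof -
  obtain g where g: "g \<in> Lp \<Omega> p" "has_weak_gradient \<Omega> v g"
    using assms by (auto simp: W1p_def)
  show "v \<in> Lp \<Omega> p" using assms by (simp add: W1p_def)
  show *: "has_weak_gradient \<Omega> v (wg v)"
    unfolding weak_gradient_def by (rule someI[of "has_weak_gradient \<Omega> v", OF g(2)])
  show "wg v \<in> Lp \<Omega> p"
    by (rule Lp_AE_eq[OF g(1) weak_gradient_unique[OF g(2) *]])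
qed

lemma W1p_linear:
  assumes "v \<in> W1p \<Omega> p" "w \<in> W1p \<Omega> p"
  shows "(\<lambda>x. a * v x + b * w x) \<in> W1p \<Omega> p"
    "AE x in lebesgue_on \<Omega>. a *\<^sub>R wg v x + b *\<^sub>R wg w x = wg (\<lambda>x. a * v x + b * w x) x"
proof -
  have *: "has_weak_gradient \<Omega> (\<lambda>x. a * v x + b * w x) (\<lambda>x. a *\<^sub>R wg v x + b *\<^sub>R wg w x)"
    by (intro has_weak_gradient_linear W1pD assms)
  then show 1: "(\<lambda>x. a * v x + b * w x) \<in> W1p \<Omega> p"
    using pint_linear(1)[OF W1pD(3)[OF assms(1)] W1pD(3)[OF assms(2)], of a b]
      pint_linear(1)[OF W1pD(1)[OF assms(1)] W1pD(1)[OF assms(2)], of a b]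
    by (auto simp: W1p_def)
  show "AE x in lebesgue_on \<Omega>. a *\<^sub>R wg v x + b *\<^sub>R wg w x = wg (\<lambda>x. a * v x + b * w x) x"
    by (rule weak_gradient_unique[OF * W1pD(2)[OF 1]])
qed

definition sobolev_int :: "('a \<Rightarrow> real) \<Rightarrow> real" where
  "sobolev_int v = pint v + pint (wg v)"

lemma sobolev_int_nonneg: "0 \<le> sobolev_int v"
  by (simp add: sobolev_int_def pint_nonneg)

lemma W1p_norm_eq: "W1p_norm \<Omega> p v = sobolev_int v powr (1 / p)"
  by (simp add: W1p_norm_def sobolev_int_def pint_def)

text \<open>Powers with exponents \<open>p\<close> and \<open>1 / p\<close> both preserve
  convergence to 0, so limits can be followed for \<open>sobolev_int\<close>, without roots.\<close>

lemma W1p_norm_tendsto_0_iff: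
  "((\<lambda>n. W1p_norm \<Omega> p (v n)) \<longlongrightarrow> 0) F \<longleftrightarrow> ((\<lambda>n. sobolev_int (v n)) \<longlongrightarrow> 0) F"
proof
  assume "((\<lambda>n. W1p_norm \<Omega> p (v n)) \<longlongrightarrow> 0) F"
  then have "((\<lambda>n. W1p_norm \<Omega> p (v n) powr p) \<longlongrightarrow> 0) F"
    using p_gt_1 by (intro tendsto_zero_powrI[OF _ tendsto_const]) (auto simp: W1p_norm_eq)
  then show "((\<lambda>n. sobolev_int (v n)) \<longlongrightarrow> 0) F"
    using p_gt_1 by (simp add: W1p_norm_eq powr_powr sobolev_int_nonneg)
next
  assume "((\<lambda>n. sobolev_int (v n)) \<longlongrightarrow> 0) F"
  then show "((\<lambda>n. W1p_norm \<Omega> p (v n)) \<longlongrightarrow> 0) F"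
    unfolding W1p_norm_eq using p_gt_1
    by (intro tendsto_zero_powrI[OF _ tendsto_const]) (auto simp: sobolev_int_nonneg)
qed

lemma wg_linear_pint:
  assumes "v \<in> W1p \<Omega> p" "w \<in> W1p \<Omega> p"
  shows "pint (wg (\<lambda>x. a * v x + b * w x)) = pint (\<lambda>x. a *\<^sub>R wg v x + b *\<^sub>R wg w x)"
  by (rule pint_AE_eq[OF pint_linear(1)[OF W1pD(3)[OF assms(1)] W1pD(3)[OF assms(2)]]
      W1p_linear(2)[OF assms], symmetric])

lemma sobolev_int_linear:
  assumes "v \<in> W1p \<Omega> p" "w \<in> W1p \<Omega> p"
  shows "sobolev_int (\<lambda>x. a * v x + b * w x) \<le>
    2 powr p * (\<bar>a\<bar> powr p * sobolev_int v + \<bar>b\<bar> powr p * sobolev_int w)"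
  using pint_linear(2)[OF W1pD(1)[OF assms(1)] W1pD(1)[OF assms(2)], of a b]
    pint_linear(2)[OF W1pD(3)[OF assms(1)] W1pD(3)[OF assms(2)], of a b]
  unfolding sobolev_int_def wg_linear_pint[OF assms] by (simp add: algebra_simps)

lemma bounded_continuous_Lp:
  fixes g :: "'a \<Rightarrow> 'b::euclidean_space"
  assumes "continuous_on UNIV g" "\<And>x. norm (g x) \<le> B"
  shows "g \<in> Lp \<Omega> p"
proof -
  interpret finite_measure "lebesgue_on \<Omega>" by (rule finite_measure_domain)
  have [measurable]: "g \<in> borel_measurable (lebesgue_on \<Omega>)"
    using borel_measurable_continuous_onI[OF assms(1)]
    by (intro measurable_restrict_space1 measurable_completion) simp
  have "integrable (lebesgue_on \<Omega>) (\<lambda>x. norm (g x) powr p)"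
    using assms(2) p_gt_1
    by (intro integrable_const_bound[where B="B powr p"]) (auto intro!: powr_mono2)
  then show ?thesis by (simp add: Lp_def)
qed

lemma test_function_grad_bounded:
  assumes "\<phi> \<in> test_functions \<Omega>"
  obtains B where "\<And>x. norm (grad \<phi> x) \<le> B"
  using test_function_support[OF assms] continuous_compact_support_bounded[OF continuous_grad[OF assms]]
  by metis

lemma test_function_W1p:
  assumes "\<phi> \<in> test_functions \<Omega>"
  shows "\<phi> \<in> W1p \<Omega> p" "AE x in lebesgue_on \<Omega>. grad \<phi> x = wg \<phi> x" "grad \<phi> \<in> Lp \<Omega> p"
proof -
  note hw = test_function_has_weak_gradient[OF open_domain assms]
  obtain K where "compact K" "\<And>x. x \<notin> K \<Longrightarrow> \<phi> x = 0"
    using test_function_support[OF assms] by metis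
  then obtain B where B: "\<And>x. norm (\<phi> x) \<le> B"
    using continuous_compact_support_bounded[OF test_functionD(5)[OF assms]] by metis
  obtain B' where B': "\<And>x. norm (grad \<phi> x) \<le> B'"
    using test_function_grad_bounded[OF assms] by metis
  show 1: "grad \<phi> \<in> Lp \<Omega> p" by (rule bounded_continuous_Lp[OF continuous_grad[OF assms] B'])
  have "\<phi> \<in> Lp \<Omega> p" by (rule bounded_continuous_Lp[OF test_functionD(5)[OF assms] B])
  then show 2: "\<phi> \<in> W1p \<Omega> p" using 1 hw by (auto simp: W1p_def)
  show "AE x in lebesgue_on \<Omega>. grad \<phi> x = wg \<phi> x"
    by (rule weak_gradient_unique[OF hw W1pD(2)[OF 2]])
qed

lemma W1p0_W1p: "v \<in> W1p0 \<Omega> p \<Longrightarrow> v \<in> W1p \<Omega> p"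
  by (simp add: W1p0_def)

text \<open>The difference is written as a combination with coefficients \<open>1\<close> and
  \<open>-1\<close> so that the rules for linear combinations apply literally.\<close>

lemma W1p0_approx:
  assumes "v \<in> W1p0 \<Omega> p"
  obtains \<phi> where "\<And>n. \<phi> n \<in> test_functions \<Omega>" "(\<lambda>n::nat. sobolev_int (\<lambda>x. 1 * \<phi> n x + (-1) * v x)) \<longlonglongrightarrow> 0"
  using assms by (auto simp: W1p0_def W1p_norm_tendsto_0_iff)

lemma W1p0I:
  assumes "v \<in> W1p \<Omega> p" "\<And>n. \<phi> n \<in> test_functions \<Omega>" "(\<lambda>n::nat. sobolev_int (\<lambda>x. 1 * \<phi> n x + (-1) * v x)) \<longlonglongrightarrow> 0"
  shows "v \<in> W1p0 \<Omega> p"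
  using assms by (auto simp: W1p0_def W1p_norm_tendsto_0_iff)

lemma W1p0_linear:
  assumes v: "v \<in> W1p0 \<Omega> p" and w: "w \<in> W1p0 \<Omega> p"
  shows "(\<lambda>x. a * v x + b * w x) \<in> W1p0 \<Omega> p"
proof -
  obtain \<phi> where \<phi>: "\<And>n. \<phi> n \<in> test_functions \<Omega>" "(\<lambda>n::nat. sobolev_int (\<lambda>x. 1 * \<phi> n x + (-1) * v x)) \<longlonglongrightarrow> 0"
    by (rule W1p0_approx[OF v]) (rule that)
  obtain \<psi> where \<psi>: "\<And>n. \<psi> n \<in> test_functions \<Omega>" "(\<lambda>n::nat. sobolev_int (\<lambda>x. 1 * \<psi> n x + (-1) * w x)) \<longlonglongrightarrow> 0"
    by (rule W1p0_approx[OF w]) (rule that)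
  let ?r = "\<lambda>n. sobolev_int (\<lambda>x. a * (1 * \<phi> n x + (-1) * v x) + b * (1 * \<psi> n x + (-1) * w x))"
  have "?r \<longlonglongrightarrow> 0"
  proof (rule tendsto_sandwich[OF _ _ tendsto_const])
    show "(\<lambda>n. 2 powr p * (\<bar>a\<bar> powr p * sobolev_int (\<lambda>x. 1 * \<phi> n x + (-1) * v x)
        + \<bar>b\<bar> powr p * sobolev_int (\<lambda>x. 1 * \<psi> n x + (-1) * w x))) \<longlonglongrightarrow> 0"
      using \<phi>(2) \<psi>(2) by (auto intro!: tendsto_eq_intros)
    show "\<forall>\<^sub>F n in sequentially. 0 \<le> ?r n" by (simp add: sobolev_int_nonneg)
    show "\<forall>\<^sub>F n in sequentially. ?r n \<le> 2 powr p * (\<bar>a\<bar> powr p * sobolev_int (\<lambda>x. 1 * \<phi> n x + (-1) * v x)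
        + \<bar>b\<bar> powr p * sobolev_int (\<lambda>x. 1 * \<psi> n x + (-1) * w x))"
      by (intro always_eventually allI sobolev_int_linear W1p_linear(1) W1p0_W1p v w test_function_W1p \<phi>(1) \<psi>(1))
  qed
  moreover have eq: "a * (1 * \<phi> n x + (-1) * v x) + b * (1 * \<psi> n x + (-1) * w x)
      = 1 * (a * \<phi> n x + b * \<psi> n x) + (-1) * (a * v x + b * w x)" for n x
    by (simp add: algebra_simps)
  ultimately have lim: "(\<lambda>n. sobolev_int (\<lambda>x. 1 * (a * \<phi> n x + b * \<psi> n x) + (-1) * (a * v x + b * w x))) \<longlonglongrightarrow> 0"
    by (simp only: eq)
  show ?thesis
    by (rule W1p0I[OF W1p_linear(1)[OF W1p0_W1p[OF v] W1p0_W1p[OF w]]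
        test_function_linear[OF \<phi>(1) \<psi>(1)] lim])
qed

lemma test_function_W1p0:
  assumes "\<phi> \<in> test_functions \<Omega>"
  shows "\<phi> \<in> W1p0 \<Omega> p"
proof (rule W1p0I[where \<phi>="\<lambda>_. \<phi>"])
  \<comment> \<open>Even the weak gradient of the zero function is a chosen representative. That its
    norm vanishes follows from linearity with both coefficients 0.\<close>
  have "sobolev_int (\<lambda>x. 0 * \<phi> x + 0 * \<phi> x) \<le> 0"
    using sobolev_int_linear[OF test_function_W1p(1)[OF assms] test_function_W1p(1)[OF assms], of 0 0] by simp
  then have "sobolev_int (\<lambda>x. 0) = 0" using sobolev_int_nonneg[of "\<lambda>x. 0"] by simp
  then show "(\<lambda>n::nat. sobolev_int (\<lambda>x. 1 * \<phi> x + (-1) * \<phi> x)) \<longlonglongrightarrow> 0" by simp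
qed (use assms test_function_W1p in auto)

text \<open>The inequality passes from test functions to their limits. One factor \<open>Q\<close>
  comes from splitting \<open>v\<close> and one from splitting the gradient of
  \<open>\<phi> n\<close>; this loss is irrelevant, as only some constant is wanted.\<close>

lemma Poincare:
  obtains C where "C > 0" "\<And>v. v \<in> W1p0 \<Omega> p \<Longrightarrow> pint v \<le> C * pint (wg v)"
proof -
  obtain R where R: "R > 0" "\<And>x. x \<in> \<Omega> \<Longrightarrow> norm x \<le> R"
    using bounded_domain by (meson bounded_pos)
  define C0 where "C0 = (2 * p * R) powr p"
  define Q where "Q = (2::real) powr p"
  have C0: "C0 > 0" and Q: "Q > 0" using R p_gt_1 by (simp_all add: C0_def Q_def)
  have "pint v \<le> Q * C0 * Q * pint (wg v)" if v: "v \<in> W1p0 \<Omega> p" for v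
  proof -
    obtain \<phi> where \<phi>: "\<And>n. \<phi> n \<in> test_functions \<Omega>" "(\<lambda>n::nat. sobolev_int (\<lambda>x. 1 * \<phi> n x + (-1) * v x)) \<longlonglongrightarrow> 0"
      by (rule W1p0_approx[OF v]) (rule that)
    define d where "d n x = 1 * \<phi> n x + (-1) * v x" for n x
    note v1 = W1p0_W1p[OF v] and \<phi>1 = test_function_W1p(1)[OF \<phi>(1)]
    have d1: "d n \<in> W1p \<Omega> p" for n unfolding d_def by (intro W1p_linear v1 \<phi>1)
    have "pint v \<le> Q * sobolev_int (d n) + Q * C0 * Q * (sobolev_int (d n) + pint (wg v))" for n
    proof -
      have "pint v = pint (\<lambda>x. (-1) *\<^sub>R d n x + 1 *\<^sub>R \<phi> n x)" by (simp add: d_def)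
      also have "\<dots> \<le> Q * (pint (d n) + pint (\<phi> n))"
        using pint_linear(2)[OF W1pD(1)[OF d1] W1pD(1)[OF \<phi>1], of "-1" n 1 n] by (simp add: Q_def)
      also have "pint (\<phi> n) \<le> C0 * pint (grad (\<phi> n))"
        using Poincare_test_function[OF open_domain R(2,1) p_gt_1 \<phi>(1)] by (simp add: C0_def pint_def)
      also have "pint (grad (\<phi> n)) = pint (wg (\<phi> n))"
        by (rule pint_AE_eq[OF test_function_W1p(3,2)]) (rule \<phi>(1))+
      also have "\<phi> n = (\<lambda>x. 1 * d n x + 1 * v x)" by (simp add: d_def)
      also have "pint (wg \<dots>) \<le> Q * (pint (wg (d n)) + pint (wg v))"
        using wg_linear_pint[OF d1 v1, of 1 n 1] pint_linear(2)[OF W1pD(3)[OF d1] W1pD(3)[OF v1], of 1 n 1]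
        by (simp add: Q_def)
      finally have "pint v \<le> Q * (pint (d n) + C0 * (Q * (pint (wg (d n)) + pint (wg v))))"
        using C0 Q by simp
      also have "\<dots> = Q * pint (d n) + Q * C0 * Q * (pint (wg (d n)) + pint (wg v))"
        by (simp add: algebra_simps)
      also have "\<dots> \<le> Q * sobolev_int (d n) + Q * C0 * Q * (sobolev_int (d n) + pint (wg v))"
        using C0 Q pint_nonneg[of "d n"] pint_nonneg[of "wg (d n)"]
        by (intro add_mono mult_left_mono) (auto simp: sobolev_int_def)
      finally show ?thesis .
    qed
    moreover have "(\<lambda>n. Q * sobolev_int (d n) + Q * C0 * Q * (sobolev_int (d n) + pint (wg v)))
        \<longlonglongrightarrow> Q * 0 + Q * C0 * Q * (0 + pint (wg v))"
      using \<phi>(2) unfolding d_def by (intro tendsto_intros)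
    ultimately show ?thesis
      by (metis (no_types, lifting) LIMSEQ_le_const add_0 mult_zero_right)
  qed
  then show ?thesis using that[of "Q * C0 * Q"] C0 Q by simp
qed

text \<open>The first factor can be made arbitrarily close to 1, at the expense of the second. This
  yields upper semicontinuity of the gradient integral, for which the factor \<open>2 powr p\<close>
  would be too coarse.\<close>

lemma norm_add_powr_split:
  fixes a b :: "'b::euclidean_space"
  assumes "\<eta> > 0"
  shows "norm (a + b) powr p \<le> (1 + \<eta>) powr p * norm a powr p + (1 + 1 / \<eta>) powr p * norm b powr p"
proof (cases "norm b \<le> \<eta> * norm a")
  case True
  have "norm (a + b) powr p \<le> ((1 + \<eta>) * norm a) powr p"
    using True norm_triangle_ineq[of a b] p_gt_1 by (intro powr_mono2) (auto simp: algebra_simps)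
  then show ?thesis by (simp add: powr_mult add_increasing2)
next
  case False
  then have "norm a \<le> norm b / \<eta>" using assms by (simp add: field_simps)
  then have "norm (a + b) powr p \<le> ((1 + 1 / \<eta>) * norm b) powr p"
    using norm_triangle_ineq[of a b] p_gt_1 by (intro powr_mono2) (auto simp: algebra_simps)
  then show ?thesis by (simp add: powr_mult add_increasing)
qed

lemma pint_add_split:
  fixes g h :: "'a \<Rightarrow> 'b::euclidean_space"
  assumes "g \<in> Lp \<Omega> p" "h \<in> Lp \<Omega> p" "\<eta> > 0"
  shows "pint (\<lambda>x. g x + h x) \<le> (1 + \<eta>) powr p * pint g + (1 + 1 / \<eta>) powr p * pint h"
proof -
  have "(\<lambda>x. g x + h x) \<in> Lp \<Omega> p" using pint_linear(1)[OF assms(1,2), of 1 1] by simp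
  then have "pint (\<lambda>x. g x + h x)
      \<le> (LINT x|lebesgue_on \<Omega>. (1 + \<eta>) powr p * norm (g x) powr p + (1 + 1 / \<eta>) powr p * norm (h x) powr p)"
    unfolding pint_def using LpD(2)[OF assms(1)] LpD(2)[OF assms(2)] norm_add_powr_split[OF assms(3)]
    by (intro integral_mono LpD(2)) auto
  then show ?thesis
    unfolding pint_def using LpD(2)[OF assms(1)] LpD(2)[OF assms(2)] by simp
qed

end

section \<open>Convexity and convergence of minimizers\<close>

text \<open>The mean value theorem on the two halves of the interval compares increments of equal
  length, and the derivative is strictly increasing.\<close>

lemma powr_midpoint_less:
  fixes s t :: real
  assumes "1 < p" "0 \<le> s" "s < t"
  shows "((s + t) / 2) powr p < (s powr p + t powr p) / 2"
proof -
  define m where "m = (s + t) / 2"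
  have m: "s < m" "m < t" "m - s = t - m" using assms by (auto simp: m_def field_simps)
  have *: "\<exists>z. a < z \<and> z < b \<and> \<bar>b\<bar> powr p - \<bar>a\<bar> powr p = (b - a) * (p * \<bar>z\<bar> powr (p - 1) * sgn z)"
    if "a < b" for a b :: real
    by (rule MVT2[OF that DERIV_abs_powr[OF assms(1)]])
  obtain z1 where z1: "s < z1" "z1 < m" "m powr p - s powr p = (m - s) * (p * z1 powr (p - 1))"
    using *[OF m(1)] assms m by (auto simp: sgn_if)
  obtain z2 where z2: "m < z2" "z2 < t" "t powr p - m powr p = (t - m) * (p * z2 powr (p - 1))"
    using *[OF m(2)] assms m by (auto simp: sgn_if)
  have "z1 powr (p - 1) < z2 powr (p - 1)"
    using z1 z2 assms by (intro powr_less_mono2) auto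
  then have "m powr p - s powr p < t powr p - m powr p"
    unfolding z1(3) z2(3) m(3) using m assms by (intro mult_strict_left_mono) auto
  then show ?thesis by (simp add: m_def)
qed

text \<open>For different lengths the scalar inequality is strict. For equal lengths the triangle
  inequality is strict, since equality would make the vectors parallel and hence equal.\<close>

lemma norm_powr_midpoint_less:
  fixes a b :: "'b::euclidean_space"
  assumes "1 < p" "a \<noteq> b"
  shows "norm ((1/2) *\<^sub>R (a + b)) powr p < (norm a powr p + norm b powr p) / 2"
proof -
  have n: "norm ((1/2) *\<^sub>R (a + b)) = norm (a + b) / 2" by simp
  have le: "norm (a + b) \<le> norm a + norm b" by (rule norm_triangle_ineq)
  show ?thesis
  proof (cases "norm a = norm b")
    case False
    have "(norm (a + b) / 2) powr p \<le> ((norm a + norm b) / 2) powr p"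
      using le assms by (intro powr_mono2) auto
    also have "\<dots> < (norm a powr p + norm b powr p) / 2"
      using False powr_midpoint_less[OF assms(1), of "norm a" "norm b"]
        powr_midpoint_less[OF assms(1), of "norm b" "norm a"]
      by (cases "norm a < norm b") (auto simp: add.commute)
    finally show ?thesis using n by simp
  next
    case True
    have "norm (a + b) \<noteq> norm a + norm b"
    proof
      assume "norm (a + b) = norm a + norm b"
      then have "norm a *\<^sub>R b = norm b *\<^sub>R a" by (simp add: norm_triangle_eq)
      then show False using True assms(2) by auto
    qed
    then have "norm (a + b) / 2 < norm a" using le True by simp
    then have "(norm (a + b) / 2) powr p < norm a powr p"
      using assms by (intro powr_less_mono2) auto
    then show ?thesis using True n by simp
  qed
qed

lemma norm_powr_midpoint_le:
  fixes a b :: "'b::euclidean_space"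
  assumes "1 < p"
  shows "norm ((1/2) *\<^sub>R (a + b)) powr p \<le> (norm a powr p + norm b powr p) / 2"
proof (cases "a = b")
  case True
  then have "(1/2) *\<^sub>R (a + b) = a" by (simp add: scaleR_half_double[symmetric] flip: scaleR_2)
  then show ?thesis using True by simp
qed (use norm_powr_midpoint_less[OF assms] less_imp_le in blast)

text \<open>Uniform convexity, obtained from strict convexity by compactness of the set where
  \<open>norm a powr p + norm b powr p = 1\<close> and homogeneity.\<close>

lemma norm_powr_uniformly_convex:
  assumes "1 < p" "\<delta> > 0"
  obtains c :: real where "c > 0"
    "\<And>a b :: 'b::euclidean_space. norm (a - b) powr p \<le> \<delta> * (norm a powr p + norm b powr p) +
      2 powr p / c * ((norm a powr p + norm b powr p) / 2 - norm ((1/2) *\<^sub>R (a + b)) powr p)"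
proof -
  define S where "S z = norm (fst z) powr p + norm (snd z) powr p" for z :: "'b \<times> 'b"
  define F where "F z = S z / 2 - norm ((1/2) *\<^sub>R (fst z + snd z)) powr p" for z :: "'b \<times> 'b"
  \<comment> \<open>On normalized pairs that stay apart, the convexity gap \<open>F\<close> is
    positive and continuous, so compactness bounds it below by some \<open>c > 0\<close>.\<close>
  define K where "K = {z :: 'b \<times> 'b. S z = 1 \<and> \<delta> \<le> norm (fst z - snd z) powr p}"
  have cS: "continuous_on UNIV S" and cF: "continuous_on UNIV F"
    and cd: "continuous_on UNIV (\<lambda>z :: 'b \<times> 'b. norm (fst z - snd z) powr p)"
    unfolding S_def F_def using assms(1) by (intro continuous_intros continuous_on_powr'; simp)+
  have "closed K"
    unfolding K_def by (intro closed_Collect_conj closed_Collect_eq closed_Collect_le cS cd continuous_on_const)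
  moreover have "norm z \<le> 2" if "z \<in> K" for z
  proof -
    have *: "s \<le> 1" if "s powr p \<le> 1" "s \<ge> 0" for s :: real
      using that assms(1) powr_less_mono2[of p 1 s] by fastforce
    have "norm (fst z) powr p \<le> 1" "norm (snd z) powr p \<le> 1"
      using that powr_ge_zero[of "norm (fst z)" p] powr_ge_zero[of "norm (snd z)" p]
      unfolding K_def S_def by (simp_all, linarith+)
    then have "norm (fst z) \<le> 1" "norm (snd z) \<le> 1" using * by auto
    then show ?thesis using norm_Pair_le[of "fst z" "snd z"] by simp
  qed
  ultimately have "compact K" using compact_eq_bounded_closed boundedI by blast
  have pos: "F z > 0" if "z \<in> K" for z
  proof -
    have "fst z \<noteq> snd z" using that assms by (auto simp: K_def)
    then show ?thesis using norm_powr_midpoint_less[OF assms(1)] by (simp add: F_def S_def)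
  qed
  obtain c where c: "c > 0" "\<And>z. z \<in> K \<Longrightarrow> c \<le> F z"
  \<comment> \<open>For large \<open>\<delta>\<close> there are no such pairs, and any positive
    \<open>c\<close> will do.\<close>
  proof (cases "K = {}")
    case True
    then show ?thesis using that[of 1] by simp
  next
    case False
    then obtain z where "z \<in> K" "\<And>y. y \<in> K \<Longrightarrow> F z \<le> F y"
      using continuous_attains_inf[OF \<open>compact K\<close> False] continuous_on_subset[OF cF] by blast
    then show ?thesis using that pos by blast
  qed
  have F0: "F z \<ge> 0" for z
    using norm_powr_midpoint_le[OF assms(1), of "fst z" "snd z"] by (simp add: F_def S_def)
  have main: "c * S (a, b) \<le> F (a, b)" if d: "\<delta> * S (a, b) \<le> norm (a - b) powr p" for a b
  proof (cases "S (a, b) > 0")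
    case True
    \<comment> \<open>Scaling by \<open>t\<close> normalizes the pair; \<open>S\<close> and
      \<open>F\<close> are homogeneous of degree \<open>p\<close>.\<close>
    define t where "t = S (a, b) powr (- 1 / p)"
    have t: "t > 0" "t powr p = 1 / S (a, b)"
      using True assms(1) powr_powr[of "S (a, b)" "- 1 / p" p] powr_minus_divide[of "S (a, b)" 1]
      by (auto simp: t_def)
    have n: "norm (t *\<^sub>R v) powr p = norm v powr p / S (a, b)" for v :: 'b
      using t by (simp add: powr_mult)
    have S1: "S (t *\<^sub>R a, t *\<^sub>R b) = 1"
      using True n unfolding S_def[of "(t *\<^sub>R a, t *\<^sub>R b)"] fst_conv snd_conv
      by (simp add: add_divide_distrib[symmetric] S_def)
    have "F (t *\<^sub>R a, t *\<^sub>R b) = F (a, b) / S (a, b)"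
    proof -
      have "(1/2) *\<^sub>R (t *\<^sub>R a + t *\<^sub>R b) = t *\<^sub>R ((1/2) *\<^sub>R (a + b))" by (simp add: algebra_simps)
      then show ?thesis
        using n[of "(1/2) *\<^sub>R (a + b)"] S1 True unfolding F_def fst_conv snd_conv
        by (simp only:) (simp add: field_simps)
    qed
    moreover have "(t *\<^sub>R a, t *\<^sub>R b) \<in> K"
    proof -
      have "norm (t *\<^sub>R a - t *\<^sub>R b) powr p = norm (a - b) powr p / S (a, b)"
        using n[of "a - b"] by (simp only: scaleR_diff_right)
      then show ?thesis using d True S1 unfolding K_def by (simp add: pos_le_divide_eq)
    qed
    ultimately have "c \<le> F (a, b) / S (a, b)" using c(2) by metis
    then show ?thesis using True by (simp add: pos_le_divide_eq)
  next
    case False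
    then have "S (a, b) \<le> 0" by simp
    then have "c * S (a, b) \<le> 0" using c(1) by (simp add: mult_nonneg_nonpos)
    then show ?thesis using F0[of "(a, b)"] by linarith
  qed
  have S0: "S z \<ge> 0" for z by (simp add: S_def)
  \<comment> \<open>If the pair is close, the term with \<open>\<delta>\<close> suffices. Otherwise
    the crude bound \<open>2 powr p * S (a, b)\<close> is converted into the gap by
    \<open>c * S (a, b) \<le> F (a, b)\<close>, which is where the constant
    \<open>2 powr p / c\<close> originates.\<close>
  have "norm (a - b) powr p \<le> \<delta> * S (a, b) + 2 powr p / c * F (a, b)" for a b
  proof (cases "\<delta> * S (a, b) \<le> norm (a - b) powr p")
    case True
    have "norm (a - b) powr p \<le> 2 powr p * S (a, b)"
      using norm_add_powr_le[OF assms(1), of a "- b"] by (simp add: S_def)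
    also have "\<dots> \<le> 2 powr p / c * F (a, b)"
      using main[OF True] c(1) by (simp add: field_simps)
    finally show ?thesis using S0[of "(a, b)"] assms(2) by (simp add: add_increasing)
  next
    case False
    moreover have "0 \<le> 2 powr p / c * F (a, b)" using F0 c(1) by simp
    ultimately show ?thesis by linarith
  qed
  then show ?thesis using that[OF c(1)] by (simp add: S_def F_def)
qed

section \<open>Comparison of \<open>kappa\<close> with the p-th power\<close>

lemma powr_le_quadratic:
  fixes c t :: real
  assumes "1 < p" "p < 2" "c > 0" "t \<ge> 0"
  shows "1 / p * t powr p \<le> 1 / 2 * c powr (p - 2) * t\<^sup>2 + (1 / p - 1 / 2) * c powr p"
proof (cases "t = 0")
  case True
  then show ?thesis using assms by (simp add: field_simps)
next
  case False
  then have t: "t > 0" using assms by simp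
  \<comment> \<open>Young's inequality with weights \<open>p / 2\<close> and
    \<open>1 - p / 2\<close>, legitimate because \<open>p < 2\<close>; the factors are chosen so
    that the powers of \<open>c\<close> cancel in the product.\<close>
  have "(c powr (p - 2) * t\<^sup>2) powr (p / 2) * (c powr p) powr (1 - p / 2)
      \<le> p / 2 * (c powr (p - 2) * t\<^sup>2) + (1 - p / 2) * c powr p"
    using assms t by (intro Youngs_inequality_0) auto
  also have "(c powr (p - 2) * t\<^sup>2) powr (p / 2) * (c powr p) powr (1 - p / 2) = t powr p"
  proof -
    have "t\<^sup>2 = t powr 2" using t by simp
    then have "(c powr (p - 2) * t\<^sup>2) powr (p / 2) * (c powr p) powr (1 - p / 2)
       = t powr p * c powr ((p - 2) * (p / 2) + p * (1 - p / 2))"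
      by (simp only: powr_mult powr_powr powr_add) simp
    also have "(p - 2) * (p / 2) + p * (1 - p / 2) = 0" by (simp add: field_simps)
    finally show ?thesis using assms by simp
  qed
  finally show ?thesis using assms by (simp add: field_simps)
qed

text \<open>Both quadratic branches are instances of the same Young bound, with \<open>c\<close>
  equal to \<open>em\<close> and to \<open>ep\<close>.\<close>

lemma kappa_ge:
  assumes "1 < p" "p < 2" "0 < em" "em \<le> ep" "t \<ge> 0"
  shows "1 / p * t powr p \<le> kappa p em ep t"
  using powr_le_quadratic[of p em t] powr_le_quadratic[of p ep t] assms unfolding kappa_def by auto

text \<open>The inner quadratic branch is increasing and reaches \<open>1 / p * em powr p\<close> at
  \<open>em\<close>; the assumption \<open>t \<le> ep\<close> excludes the outer branch.\<close>

lemma kappa_le: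
  assumes "1 < p" "p < 2" "0 < em" "0 \<le> t" "t \<le> ep"
  shows "kappa p em ep t \<le> 1 / p * t powr p + 1 / p * em powr p"
proof (cases "t \<le> em")
  case True
  have "em powr (p - 2) * t\<^sup>2 \<le> em powr (p - 2) * em\<^sup>2"
    using True assms by (intro mult_left_mono power_mono) auto
  also have "em\<^sup>2 = em powr 2" using assms by simp
  also have "em powr (p - 2) * em powr 2 = em powr p" by (simp flip: powr_add)
  finally have "kappa p em ep t \<le> 1 / p * em powr p"
    using True by (simp add: kappa_def algebra_simps)
  then show ?thesis using assms by (simp add: add_increasing)
next
  case False
  then show ?thesis using assms by (simp add: kappa_def)
qed

section \<open>Energy estimates: density, coercivity, stability of the minimizer\<close>

locale dual_functional = sobolev_domain +
  fixes f :: "('a \<Rightarrow> real) \<Rightarrow> real"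
  assumes dual: "f \<in> W1p0_dual \<Omega> p" and p_less_2: "p < 2"
begin

lemma f_linear:
  assumes "v \<in> W1p0 \<Omega> p" "w \<in> W1p0 \<Omega> p"
  shows "f (\<lambda>x. a * v x + b * w x) = a * f v + b * f w"
proof -
  have "(\<lambda>x. a * v x) \<in> W1p0 \<Omega> p" "(\<lambda>x. b * w x) \<in> W1p0 \<Omega> p"
    using W1p0_linear[OF assms(1,1), of a 0] W1p0_linear[OF assms(2,2), of b 0] by simp_all
  then have "f (\<lambda>x. a * v x + b * w x) = f (\<lambda>x. a * v x) + f (\<lambda>x. b * w x)"
    using dual by (simp add: W1p0_dual_def)
  then show ?thesis using dual assms by (simp add: W1p0_dual_def)
qed

lemma f_bounded:
  obtains C where "C \<ge> 0" "\<And>v. v \<in> W1p0 \<Omega> p \<Longrightarrow> \<bar>f v\<bar> \<le> C * W1p_norm \<Omega> p v"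
proof -
  obtain C where C: "\<And>v. v \<in> W1p0 \<Omega> p \<Longrightarrow> \<bar>f v\<bar> \<le> C * W1p_norm \<Omega> p v"
    using dual unfolding W1p0_dual_def by blast
  have "\<bar>f v\<bar> \<le> \<bar>C\<bar> * W1p_norm \<Omega> p v" if "v \<in> W1p0 \<Omega> p" for v
    using C[OF that] mult_right_mono[OF abs_ge_self, of "W1p_norm \<Omega> p v" C]
    by (simp add: W1p_norm_eq)
  then show ?thesis using that[of "\<bar>C\<bar>"] by simp
qed

abbreviation J where "J \<equiv> energy \<Omega> p f"

lemma J_eq: "J v = 1 / p * pint (wg v) - f v"
  by (simp add: energy_def pint_def)

lemma J_approx:
  assumes v: "v \<in> W1p0 \<Omega> p" and "\<delta> > 0"
  obtains \<phi> where "\<phi> \<in> test_functions \<Omega>" "J \<phi> < J v + \<delta>"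
proof -
  obtain C where C: "C \<ge> 0" "\<And>v. v \<in> W1p0 \<Omega> p \<Longrightarrow> \<bar>f v\<bar> \<le> C * W1p_norm \<Omega> p v"
    using f_bounded by metis
  let ?A = "pint (wg v)"
  \<comment> \<open>\<open>\<eta>\<close> has to be fixed before \<open>n\<close>: the factor
    \<open>(1 + 1 / \<eta>) powr p\<close> blows up for small \<open>\<eta>\<close>, and only the
    subsequent limit in \<open>n\<close> removes it.\<close>
  have "((\<lambda>\<eta>. 1 / p * ((1 + \<eta>) powr p * ?A)) \<longlongrightarrow> 1 / p * ((1 + 0) powr p * ?A)) (at_right 0)"
    by (intro tendsto_intros) auto
  then have "\<forall>\<^sub>F \<eta> in at_right 0. 1 / p * ((1 + \<eta>) powr p * ?A) < 1 / p * ?A + \<delta>"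
    using assms(2) by (intro order_tendstoD(2)) auto
  then obtain \<eta> where \<eta>: "\<eta> > 0" "1 / p * ((1 + \<eta>) powr p * ?A) < 1 / p * ?A + \<delta>"
    using eventually_happens'[OF _ eventually_conj[OF eventually_at_right_less[of 0]]] trivial_limit_at_right_real
    by (metis (no_types, lifting))
  obtain \<phi> where \<phi>: "\<And>n. \<phi> n \<in> test_functions \<Omega>" "(\<lambda>n::nat. sobolev_int (\<lambda>x. 1 * \<phi> n x + (-1) * v x)) \<longlonglongrightarrow> 0"
    by (rule W1p0_approx[OF v]) (rule that)
  define d where "d n x = 1 * \<phi> n x + (-1) * v x" for n x
  have \<phi>0: "\<phi> n \<in> W1p0 \<Omega> p" for n using \<phi>(1) by (rule test_function_W1p0)
  have d0: "d n \<in> W1p0 \<Omega> p" for n unfolding d_def by (intro W1p0_linear v \<phi>0)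
  have le: "J (\<phi> n) \<le> 1 / p * ((1 + \<eta>) powr p * ?A) + 1 / p * ((1 + 1 / \<eta>) powr p * sobolev_int (d n))
      - f v + C * W1p_norm \<Omega> p (d n)" for n
  proof -
    have eq: "\<phi> n = (\<lambda>x. 1 * v x + 1 * d n x)" by (simp add: d_def)
    have "pint (wg (\<phi> n)) = pint (\<lambda>x. wg v x + wg (d n) x)"
      by (subst eq, subst wg_linear_pint) (use W1p0_W1p v d0 in auto)
    also have "\<dots> \<le> (1 + \<eta>) powr p * ?A + (1 + 1 / \<eta>) powr p * pint (wg (d n))"
      by (rule pint_add_split[OF W1pD(3) W1pD(3) \<eta>(1)]) (use W1p0_W1p v d0 in auto)
    also have "\<dots> \<le> (1 + \<eta>) powr p * ?A + (1 + 1 / \<eta>) powr p * sobolev_int (d n)"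
      using pint_nonneg[of "d n"] by (simp add: sobolev_int_def mult_left_mono)
    finally have "1 / p * pint (wg (\<phi> n)) \<le> 1 / p * ((1 + \<eta>) powr p * ?A + (1 + 1 / \<eta>) powr p * sobolev_int (d n))"
      using p_gt_1 by (intro mult_left_mono) auto
    moreover have "f (\<phi> n) = f v + f (d n)"
      using f_linear[OF v d0, of 1 1 n] eq by simp
    ultimately show ?thesis using C(2)[OF d0[of n]] unfolding J_eq by (simp add: distrib_left)
  qed
  have "(\<lambda>n. sobolev_int (d n)) \<longlonglongrightarrow> 0" using \<phi>(2) unfolding d_def .
  moreover from this have "(\<lambda>n. W1p_norm \<Omega> p (d n)) \<longlonglongrightarrow> 0" by (simp add: W1p_norm_tendsto_0_iff)
  ultimately have "(\<lambda>n. 1 / p * ((1 + \<eta>) powr p * ?A) + 1 / p * ((1 + 1 / \<eta>) powr p * sobolev_int (d n))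
      - f v + C * W1p_norm \<Omega> p (d n)) \<longlonglongrightarrow>
     1 / p * ((1 + \<eta>) powr p * ?A) + 1 / p * ((1 + 1 / \<eta>) powr p * 0) - f v + C * 0"
    by (intro tendsto_intros)
  then have "\<forall>\<^sub>F n in sequentially. 1 / p * ((1 + \<eta>) powr p * ?A) + 1 / p * ((1 + 1 / \<eta>) powr p * sobolev_int (d n))
      - f v + C * W1p_norm \<Omega> p (d n) < J v + \<delta>"
    using \<eta>(2) by (intro order_tendstoD(2)) (auto simp: J_eq)
  then obtain n where "1 / p * ((1 + \<eta>) powr p * ?A) + 1 / p * ((1 + 1 / \<eta>) powr p * sobolev_int (d n))
      - f v + C * W1p_norm \<Omega> p (d n) < J v + \<delta>"
    using eventually_happens by force
  then show ?thesis using that[OF \<phi>(1)[of n]] le[of n] by simp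
qed

text \<open>The energy is linear in \<open>X = pint (wg v)\<close>, while by Poincare's inequality
  the functional is at most a multiple of \<open>X powr (1 / p)\<close>, a power with exponent below
  1.\<close>

lemma coercive:
  obtains K where "\<And>v. v \<in> W1p0 \<Omega> p \<Longrightarrow> J v \<le> M \<Longrightarrow> pint (wg v) \<le> K"
proof -
  obtain CP where CP: "CP > 0" "\<And>v. v \<in> W1p0 \<Omega> p \<Longrightarrow> pint v \<le> CP * pint (wg v)"
    by (rule Poincare) (rule that)
  obtain C where C: "C \<ge> 0" "\<And>v. v \<in> W1p0 \<Omega> p \<Longrightarrow> \<bar>f v\<bar> \<le> C * W1p_norm \<Omega> p v"
    by (rule f_bounded) (rule that)
  define L where "L = C * (1 + CP) powr (1 / p)"
  define T where "T = p * (\<bar>M\<bar> + L)"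
  have L: "L \<ge> 0" using C by (simp add: L_def)
  have "pint (wg v) \<le> 1 + T powr (p / (p - 1))" if v: "v \<in> W1p0 \<Omega> p" and J: "J v \<le> M" for v
  proof (cases "pint (wg v) \<le> 1")
    case True
    then show ?thesis by (simp add: add_increasing2)
  next
    case False
    define X where "X = pint (wg v)"
    have X: "X > 1" using False by (simp add: X_def)
    have "sobolev_int v \<le> (1 + CP) * X"
      using CP(2)[OF v] by (simp add: sobolev_int_def X_def algebra_simps)
    then have "W1p_norm \<Omega> p v \<le> ((1 + CP) * X) powr (1 / p)"
      unfolding W1p_norm_eq using p_gt_1 by (intro powr_mono2) (auto simp: sobolev_int_nonneg)
    also have "\<dots> = (1 + CP) powr (1 / p) * X powr (1 / p)" by (rule powr_mult)
    finally have "C * W1p_norm \<Omega> p v \<le> L * X powr (1 / p)"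
      using C(1) unfolding L_def mult.assoc by (rule mult_left_mono)
    then have "f v \<le> L * X powr (1 / p)" using C(2)[OF v] by linarith
    then have "1 / p * X \<le> \<bar>M\<bar> + L * X powr (1 / p)" using J unfolding J_eq X_def by linarith
    \<comment> \<open>As \<open>X > 1\<close>, the constant can be multiplied by
      \<open>X powr (1 / p)\<close>, and this power is then divided out.\<close>
    also have "\<dots> \<le> \<bar>M\<bar> * X powr (1 / p) + L * X powr (1 / p)"
      using X p_gt_1 by (simp add: mult_left_mono ge_one_powr_ge_zero mult_le_cancel_left1)
    finally have "X \<le> T * X powr (1 / p)"
      using p_gt_1 by (simp add: T_def field_simps)
    moreover have "X = X powr (1 - 1 / p) * X powr (1 / p)"
      using X by (simp flip: powr_add)
    ultimately have "X powr (1 - 1 / p) \<le> T"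
      using X by (metis mult_le_cancel_right_pos powr_gt_zero less_trans zero_less_one less_irrefl)
    then have "(X powr (1 - 1 / p)) powr (p / (p - 1)) \<le> T powr (p / (p - 1))"
      using p_gt_1 by (intro powr_mono2) auto
    moreover have "(X powr (1 - 1 / p)) powr (p / (p - 1)) = X"
    proof -
      have eq: "(1 - 1 / p) * (p / (p - 1)) = 1" using p_gt_1 by (simp add: field_simps)
      show ?thesis unfolding powr_powr eq using X by simp
    qed
    ultimately show ?thesis by (simp add: X_def)
  qed
  then show ?thesis by (rule that)
qed

text \<open>Minimality gives \<open>J u \<le> J m\<close> at the midpoint \<open>m\<close> of
  \<open>v\<close> and \<open>u\<close>. There \<open>f\<close> cancels by linearity, so the
  convexity gap of the gradient integrals is at most \<open>p * (\<rho> / 2)\<close>, which uniform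
  convexity turns into closeness of the gradients.\<close>

lemma minimizing_converges:
  assumes u: "u \<in> W1p0 \<Omega> p" and min: "\<And>v. v \<in> W1p0 \<Omega> p \<Longrightarrow> J u \<le> J v" and "\<delta> > 0"
  obtains \<rho> where "\<rho> > 0"
    "\<And>v. v \<in> W1p0 \<Omega> p \<Longrightarrow> J v \<le> J u + \<rho> \<Longrightarrow> sobolev_int (\<lambda>x. v x - u x) < \<delta>"
proof -
  obtain CP where CP: "CP > 0" "\<And>v. v \<in> W1p0 \<Omega> p \<Longrightarrow> pint v \<le> CP * pint (wg v)"
    by (rule Poincare) (rule that)
  \<comment> \<open>The level \<open>J u + 1\<close> covers every competitor, since
    \<open>\<rho>\<close> is chosen to be at most 1.\<close>
  obtain K where K: "\<And>v. v \<in> W1p0 \<Omega> p \<Longrightarrow> J v \<le> J u + 1 \<Longrightarrow> pint (wg v) \<le> K"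
    using coercive[of "J u + 1"] by metis
  have K0: "K \<ge> 0" using K[OF u] pint_nonneg[of "wg u"] by linarith
  \<comment> \<open>The error of uniform convexity is at most \<open>\<delta>' * (2 * K)\<close>, to
    be kept below half of \<open>\<delta>\<close> after Poincare's factor \<open>1 + CP\<close>. The
    added 1 avoids division by 0 when \<open>K = 0\<close> and makes the final inequality
    strict.\<close>
  define \<delta>' where "\<delta>' = \<delta> / (2 * (1 + CP) * (2 * K + 1))"
  have \<delta>': "\<delta>' > 0" using K0 CP assms(3) by (simp add: \<delta>'_def)
  obtain c where c: "c > 0" "\<And>a b :: 'a. norm (a - b) powr p \<le> \<delta>' * (norm a powr p + norm b powr p) +
      2 powr p / c * ((norm a powr p + norm b powr p) / 2 - norm ((1/2) *\<^sub>R (a + b)) powr p)"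
    using norm_powr_uniformly_convex[OF p_gt_1 \<delta>'] by metis
  define \<rho> where "\<rho> = min 1 (\<delta> / (2 * (1 + CP) * (2 powr p / c * p)))"
  have \<rho>: "\<rho> > 0" "\<rho> \<le> 1" using assms(3) CP c p_gt_1 by (auto simp: \<rho>_def)
  have "sobolev_int (\<lambda>x. v x - u x) < \<delta>" if v: "v \<in> W1p0 \<Omega> p" and Jv: "J v \<le> J u + \<rho>" for v
  proof -
    note v1 = W1p0_W1p[OF v] and u1 = W1p0_W1p[OF u]
    note Lv = W1pD(3)[OF v1] and Lu = W1pD(3)[OF u1]
    let ?P = "pint (wg v)" and ?U = "pint (wg u)"
    define m where "m x = 1/2 * v x + 1/2 * u x" for x
    have m0: "m \<in> W1p0 \<Omega> p" unfolding m_def by (intro W1p0_linear u v)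
    have pm: "pint (wg m) = pint (\<lambda>x. (1/2) *\<^sub>R (wg v x + wg u x))"
      unfolding m_def using wg_linear_pint[OF v1 u1, of "1/2" "1/2"] by (simp add: scaleR_add_right)
    have "f m = 1/2 * f v + 1/2 * f u" unfolding m_def by (rule f_linear[OF v u])
    then have "(?P + ?U) / 2 - pint (wg m) = p * ((J v + J u) / 2 - J m)"
      using p_gt_1 by (simp add: J_eq field_simps)
    also have "\<dots> \<le> p * (\<rho> / 2)"
      using min[OF m0] Jv p_gt_1 by (intro mult_left_mono) (auto simp: field_simps)
    finally have D: "(?P + ?U) / 2 - pint (wg m) \<le> p * (\<rho> / 2)" .
    have int_m: "integrable (lebesgue_on \<Omega>) (\<lambda>x. norm ((1/2) *\<^sub>R (wg v x + wg u x)) powr p)"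
      using LpD(2)[OF pint_linear(1)[OF Lv Lu, of "1/2" "1/2"]] by (simp add: scaleR_add_right)
    have int_d: "integrable (lebesgue_on \<Omega>) (\<lambda>x. norm (wg v x - wg u x) powr p)"
      using LpD(2)[OF pint_linear(1)[OF Lv Lu, of 1 "-1"]] by simp
    have "pint (\<lambda>x. wg v x - wg u x) \<le> (LINT x|lebesgue_on \<Omega>. \<delta>' * (norm (wg v x) powr p + norm (wg u x) powr p) +
      2 powr p / c * ((norm (wg v x) powr p + norm (wg u x) powr p) / 2 - norm ((1/2) *\<^sub>R (wg v x + wg u x)) powr p))"
      unfolding pint_def
      using c(2) int_d int_m LpD(2)[OF Lv] LpD(2)[OF Lu]
      by (intro integral_mono Bochner_Integration.integrable_add Bochner_Integration.integrable_diff
          integrable_mult_right integrable_divide) auto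
    also have "\<dots> = \<delta>' * (?P + ?U) + 2 powr p / c * ((?P + ?U) / 2 - pint (wg m))"
      unfolding pm unfolding pint_def using int_m LpD(2)[OF Lv] LpD(2)[OF Lu] by simp
    also have "\<dots> \<le> \<delta>' * (2 * K) + 2 powr p / c * (p * (\<rho> / 2))"
      using K[OF v] K[OF u] Jv \<rho> \<delta>' D c(1) by (intro add_mono mult_left_mono) auto
    finally have grad_le: "pint (\<lambda>x. wg v x - wg u x) \<le> \<delta>' * (2 * K) + 2 powr p / c * (p * (\<rho> / 2))" .
    define d where "d x = 1 * v x + (-1) * u x" for x
    have d0: "d \<in> W1p0 \<Omega> p" unfolding d_def by (intro W1p0_linear u v)
    have "pint (wg d) = pint (\<lambda>x. wg v x - wg u x)"
      unfolding d_def using wg_linear_pint[OF v1 u1, of 1 "-1"] by simp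
    then have "sobolev_int d \<le> (1 + CP) * pint (\<lambda>x. wg v x - wg u x)"
      using CP(2)[OF d0] by (simp add: sobolev_int_def algebra_simps)
    also have "\<dots> \<le> (1 + CP) * (\<delta>' * (2 * K) + 2 powr p / c * (p * (\<rho> / 2)))"
      using grad_le CP by (intro mult_left_mono) auto
    also have "\<dots> = (1 + CP) * \<delta>' * (2 * K) + (1 + CP) * (2 powr p / c * p) * \<rho> / 2"
      by (simp add: algebra_simps)
    also have "\<dots> < \<delta>"
    proof -
      have "(1 + CP) * \<delta>' * (2 * K) < (1 + CP) * \<delta>' * (2 * K + 1)"
        using CP \<delta>' by (intro mult_strict_left_mono) auto
      also have "\<dots> = \<delta> / 2"
      proof -
        have "1 + CP \<noteq> 0" "2 * K + 1 \<noteq> 0" using CP(1) K0 by linarith+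
        then show ?thesis unfolding \<delta>'_def by (simp add: divide_simps)
      qed
      finally have 1: "(1 + CP) * \<delta>' * (2 * K) < \<delta> / 2" .
      define A where "A = (1 + CP) * (2 powr p / c * p)"
      have "A > 0" using CP c p_gt_1 by (simp add: A_def)
      moreover have "\<rho> \<le> \<delta> / (2 * A)"
        unfolding \<rho>_def A_def mult.assoc[symmetric] by (rule min.cobounded2)
      ultimately have "A * \<rho> \<le> \<delta> / 2" by (simp add: field_simps)
      then have "A * \<rho> / 2 \<le> \<delta> / 2" using assms(3) by simp
      then show ?thesis using 1 unfolding A_def by linarith
    qed
    finally show ?thesis unfolding d_def by simp
  qed
  then show ?thesis using that \<rho>(1) by blast
qed

text \<open>The comparison of the integrands is integrated in \<open>ennreal\<close>, so it also
  holds where the relaxed energy is infinite.\<close>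

lemma J_le_relaxed:
  assumes v: "v \<in> W1p0 \<Omega> p" and "0 < em" "em \<le> ep"
  shows "ereal (J v) \<le> relaxed_energy \<Omega> p f em ep v"
proof -
  note Lv = W1pD(3)[OF W1p0_W1p[OF v]]
  have "ennreal (1 / p * pint (wg v)) = (\<integral>\<^sup>+ x. ennreal (1 / p * norm (wg v x) powr p) \<partial>lebesgue_on \<Omega>)"
    unfolding pint_def using LpD(2)[OF Lv] p_gt_1
    by (subst nn_integral_eq_integral) (auto simp: integral_mult_right_zero[symmetric] simp del: integral_mult_right_zero)
  also have "\<dots> \<le> (\<integral>\<^sup>+ x. ennreal (kappa p em ep (norm (wg v x))) \<partial>lebesgue_on \<Omega>)"
    using kappa_ge[OF p_gt_1 p_less_2 assms(2,3)] by (intro nn_integral_mono ennreal_leI) auto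
  finally have "ereal (1 / p * pint (wg v)) \<le> enn2ereal (\<integral>\<^sup>+ x. ennreal (kappa p em ep (norm (wg v x))) \<partial>lebesgue_on \<Omega>)"
    using p_gt_1 pint_nonneg[of "wg v"] by (simp add: less_eq_ennreal.rep_eq enn2ereal_ennreal)
  from ereal_minus_mono[OF this order_refl[of "ereal (f v)"]] show ?thesis
    unfolding relaxed_energy_def J_eq by simp
qed

text \<open>The bound \<open>B \<le> ep\<close> makes \<open>kappa_le\<close> applicable almost
  everywhere, and its additive error is integrable because \<open>\<Omega>\<close> has finite
  measure.\<close>

lemma relaxed_le_J:
  assumes \<phi>: "\<phi> \<in> test_functions \<Omega>" and B: "\<And>x. norm (grad \<phi> x) \<le> B" and "0 < em" "B \<le> ep"
  shows "relaxed_energy \<Omega> p f em ep \<phi> \<le> ereal (J \<phi> + measure lebesgue \<Omega> * (1 / p * em powr p))"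
proof -
  interpret finite_measure "lebesgue_on \<Omega>" by (rule finite_measure_domain)
  note L = W1pD(3)[OF test_function_W1p(1)[OF \<phi>]]
  have int: "integrable (lebesgue_on \<Omega>) (\<lambda>x. 1 / p * norm (wg \<phi> x) powr p + 1 / p * em powr p)"
    using LpD(2)[OF L] by simp
  have "AE x in lebesgue_on \<Omega>. kappa p em ep (norm (wg \<phi> x)) \<le> 1 / p * norm (wg \<phi> x) powr p + 1 / p * em powr p"
    using test_function_W1p(2)[OF \<phi>]
  proof eventually_elim
    case (elim x)
    show ?case unfolding elim[symmetric]
      using B[of x] assms(4) by (intro kappa_le p_gt_1 p_less_2 assms(3)) auto
  qed
  then have "(\<integral>\<^sup>+ x. ennreal (kappa p em ep (norm (wg \<phi> x))) \<partial>lebesgue_on \<Omega>)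
      \<le> (\<integral>\<^sup>+ x. ennreal (1 / p * norm (wg \<phi> x) powr p + 1 / p * em powr p) \<partial>lebesgue_on \<Omega>)"
    by (intro nn_integral_mono_AE) (auto elim!: eventually_mono intro: ennreal_leI)
  also have "\<dots> = ennreal (LINT x|lebesgue_on \<Omega>. 1 / p * norm (wg \<phi> x) powr p + 1 / p * em powr p)"
    using int p_gt_1 by (intro nn_integral_eq_integral) auto
  also have "(LINT x|lebesgue_on \<Omega>. 1 / p * norm (wg \<phi> x) powr p + 1 / p * em powr p)
      = 1 / p * pint (wg \<phi>) + measure lebesgue \<Omega> * (1 / p * em powr p)"
    using LpD(2)[OF L] domain_sets by (simp add: pint_def measure_restrict_space)
  finally have "enn2ereal (\<integral>\<^sup>+ x. ennreal (kappa p em ep (norm (wg \<phi> x))) \<partial>lebesgue_on \<Omega>)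
     \<le> ereal (1 / p * pint (wg \<phi>) + measure lebesgue \<Omega> * (1 / p * em powr p))"
    using p_gt_1 pint_nonneg[of "wg \<phi>"]
    by (simp add: less_eq_ennreal.rep_eq enn2ereal_ennreal del: ennreal_plus)
  from ereal_minus_mono[OF this order_refl[of "ereal (f \<phi>)"]] show ?thesis
    unfolding relaxed_energy_def J_eq by (simp add: algebra_simps)
qed

end

section \<open>Convergence of the relaxed minimizers\<close>

theorem corollary10:
  fixes \<Omega> :: "'a::euclidean_space set"
    and p :: real
    and f :: "('a \<Rightarrow> real) \<Rightarrow> real"
    and u :: "'a \<Rightarrow> real"
    and u_eps :: "real \<Rightarrow> real \<Rightarrow> 'a \<Rightarrow> real"
  assumes "open \<Omega>" and "bounded \<Omega>"
    and "1 < p" and "p < 2"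
    and "f \<in> W1p0_dual \<Omega> p"
    and "is_arg_min (energy \<Omega> p f) (\<lambda>v. v \<in> W1p0 \<Omega> p) u"
    and "\<And>em ep. 0 < em \<Longrightarrow> em \<le> ep \<Longrightarrow>
           is_arg_min (relaxed_energy \<Omega> p f em ep) (\<lambda>v. v \<in> W1p0 \<Omega> p) (u_eps em ep)"
  shows "((\<lambda>(em, ep). W1p_norm \<Omega> p (\<lambda>x. u_eps em ep x - u x)) \<longlongrightarrow> 0)
           (at_right 0 \<times>\<^sub>F at_top)"
proof -
  interpret dual_functional \<Omega> p f
    using assms(1-5) by unfold_locales
  have u: "u \<in> W1p0 \<Omega> p" "\<And>v. v \<in> W1p0 \<Omega> p \<Longrightarrow> J u \<le> J v"
    using assms(6) by (auto simp: is_arg_min_linorder)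
  have ue: "u_eps em ep \<in> W1p0 \<Omega> p"
    "\<And>v. v \<in> W1p0 \<Omega> p \<Longrightarrow> relaxed_energy \<Omega> p f em ep (u_eps em ep) \<le> relaxed_energy \<Omega> p f em ep v"
    if "0 < em" "em \<le> ep" for em ep
    using assms(7)[OF that] by (auto simp: is_arg_min_linorder)
  have "((\<lambda>e. sobolev_int (\<lambda>x. u_eps (fst e) (snd e) x - u x)) \<longlongrightarrow> 0) (at_right 0 \<times>\<^sub>F at_top)"
  proof (rule order_tendstoI)
    fix a :: real assume "a < 0"
    then show "\<forall>\<^sub>F e in at_right 0 \<times>\<^sub>F at_top. a < sobolev_int (\<lambda>x. u_eps (fst e) (snd e) x - u x)"
      by (intro always_eventually allI less_le_trans[OF _ sobolev_int_nonneg])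
  next
    fix \<delta> :: real assume "0 < \<delta>"
    obtain \<rho> where \<rho>: "\<rho> > 0" "\<And>v. v \<in> W1p0 \<Omega> p \<Longrightarrow> J v \<le> J u + \<rho> \<Longrightarrow> sobolev_int (\<lambda>x. v x - u x) < \<delta>"
      by (rule minimizing_converges[OF u \<open>0 < \<delta>\<close>]) (assumption, rule that)
    \<comment> \<open>One half of \<open>\<rho>\<close> pays for replacing \<open>u\<close> by
      \<open>\<phi>\<close>, the other for the error in \<open>em\<close>. \<open>\<phi>\<close> and
      its gradient bound \<open>B\<close> depend on neither \<open>em\<close> nor
      \<open>ep\<close>.\<close>
    have "\<rho> / 2 > 0" using \<rho> by simp
    obtain \<phi> where \<phi>: "\<phi> \<in> test_functions \<Omega>" "J \<phi> < J u + \<rho> / 2"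
      by (rule J_approx[OF u(1) \<open>\<rho> / 2 > 0\<close>]) (rule that)
    obtain B where B: "\<And>x. norm (grad \<phi> x) \<le> B"
      by (rule test_function_grad_bounded[OF \<phi>(1)]) (rule that)
    have "((\<lambda>em. measure lebesgue \<Omega> * (1 / p * em powr p)) \<longlongrightarrow> measure lebesgue \<Omega> * (1 / p * 0)) (at_right 0)"
      using assms(3) by (intro tendsto_intros tendsto_zero_powrI[OF _ tendsto_const])
        (auto intro!: tendsto_ident_at eventually_mono[OF eventually_at_right_less[of 0]])
    then have "\<forall>\<^sub>F em in at_right 0. measure lebesgue \<Omega> * (1 / p * em powr p) < \<rho> / 2"
      using \<rho> by (intro order_tendstoD(2)) auto
    moreover have "\<forall>\<^sub>F em in at_right (0::real). 0 < em \<and> em < 1"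
      by (auto simp: eventually_at_right_field intro!: exI[of _ 1])
    ultimately have 1: "\<forall>\<^sub>F em in at_right 0. measure lebesgue \<Omega> * (1 / p * em powr p) < \<rho> / 2 \<and> 0 < em \<and> em < 1"
      by (rule eventually_conj)
    \<comment> \<open>The threshold \<open>B\<close> keeps the gradient of \<open>\<phi>\<close> off
      the outer branch. The threshold 1, together with \<open>em < 1\<close>, secures
      \<open>em \<le> ep\<close>, which the product filter does not supply by itself.\<close>
    have 2: "\<forall>\<^sub>F ep in at_top. max B 1 \<le> ep" by (rule eventually_ge_at_top)
    show "\<forall>\<^sub>F e in at_right 0 \<times>\<^sub>F at_top. sobolev_int (\<lambda>x. u_eps (fst e) (snd e) x - u x) < \<delta>"
      using eventually_prodI[OF 1 2]
    proof eventually_elim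
      case (elim e)
      obtain em ep where e: "e = (em, ep)" by (cases e)
      have *: "0 < em" "em \<le> ep" "B \<le> ep" "measure lebesgue \<Omega> * (1 / p * em powr p) < \<rho> / 2"
        using elim e by auto
      have "ereal (J (u_eps em ep)) \<le> relaxed_energy \<Omega> p f em ep (u_eps em ep)"
        by (rule J_le_relaxed[OF ue(1)[OF *(1,2)] *(1,2)])
      also have "\<dots> \<le> relaxed_energy \<Omega> p f em ep \<phi>"
        by (rule ue(2)[OF *(1,2) test_function_W1p0[OF \<phi>(1)]])
      also have "\<dots> \<le> ereal (J \<phi> + measure lebesgue \<Omega> * (1 / p * em powr p))"
        by (rule relaxed_le_J[OF \<phi>(1) B *(1,3)])
      finally have "J (u_eps em ep) \<le> J \<phi> + measure lebesgue \<Omega> * (1 / p * em powr p)"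
        by (simp only: ereal_less_eq)
      then have "J (u_eps em ep) \<le> J u + \<rho>" using \<phi>(2) *(4) by linarith
      then show ?case using \<rho>(2)[OF ue(1)[OF *(1,2)]] e by simp
    qed
  qed
  then show ?thesis
    by (simp add: W1p_norm_tendsto_0_iff[symmetric] case_prod_unfold)
qed

end
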